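(* Let $H$ be a Hilbert space, $U_1: H \rightrightarrows H$ maximal monotone and $U_2:H \to H$ $\delta$-cocoercive, for some $\delta >0$. Let $c \in (0,2\delta]$. Given $(\alpha_n) \subset [0,1]$, $(\beta_n) \subset [1-\frac{4\delta-c}{2\delta},1]$, and $x_0, u \in H$, let $(x_n)$ be generated from $x_0$ by $$x_{2n+1}=(1-\alpha_n)x_{2n}+\alpha_nu,\qquad x_{2n+2}=(1-\beta_n)J_{cU_1}\left(x_{2n+1}-cU_2(x_{2n+1})\right)+ \beta_n x_{2n+1}\qquad(n\in\mathbb{N}).$$ Assume that $\Gamma_1,\Gamma_3,\Gamma_4:(0,+\infty)\to\mathbb{N}$ and $\Gamma_2:\mathbb{N}\to\mathbb{N}$ are monotone functions such that: (Q1) for all $\varepsilon>0$ and all $n\ge\Gamma_1(\varepsilon)$, $\alpha_n\le\varepsilon$; (Q2) for all $k\in\mathbb{N}$, $\sum_{i=0}^{\Gamma_2(k)}\alpha_i\ge k$; (Q3) for all $\varepsilon>0$ and $n\in\mathbb{N}$, $\sum_{i=\Gamma_3(\varepsilon)+1}^{\Gamma_3(\varepsilon)+n}|\alpha_{i+1}-\alpha_i|\le\varepsilon$; (Q4) for all $\varepsilon>0$ and $n\in\mathbb{N}$, $\sum_{i=\Gamma_4(\varepsilon)+1}^{\Gamma_4(\varepsilon)+n}|\beta_{i+1}-\beta_i|\le\varepsilon$. Assume that there exist $N \in \mathbb{N} \setminus\{0\}$ such that $N \geq \max\{\|x_0-p\|,2\|u-p\|\}$ for some $p \in \mathrm{zer}(U_1+U_2)$,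 and $\gamma \in(0,1]$ satisfying $1-\frac{4\delta-c}{2\delta}+\gamma\leq \beta_n\leq 1-\gamma$ for all $n\in \mathbb{N}$. Then $(x_n)$ converges strongly to $P_{\mathrm{zer}(U_1+U_2)}(u)$ and $$\mu_2:=\mu[N,\gamma/2,\Gamma_1, \Gamma_2, \Gamma_3, \Gamma_4]$$ is a rate of metastability for $(x_n)$, where $\mu$ is the functional defined in the context.
   Context: $\mathrm{zer}(A)=\{x: 0\in A(x)\}$. A multi-valued operator $A:H\rightrightarrows H$ is monotone if $\langle x-x',y-y'\rangle\ge0$ for all $(x,y),(x',y')$ in its graph, and maximal monotone if its graph is not properly contained in the graph of another monotone operator. $J_{cA}=(\mathrm{Id}+cA)^{-1}$ is the (single-valued) resolvent. $U_2$ is $\delta$-cocoercive if $\langle x-y,U_2(x)-U_2(y)\rangle\ge\delta\|U_2(x)-U_2(y)\|^2$ for all $x,y\in H$. $P_S$ is the metric projection onto the nonempty closed convex set $S$. Monotone functions: $\varepsilon\le\varepsilon'$ implies $\Gamma_i(\varepsilon)\ge\Gamma_i(\varepsilon')$ for $i=1,3,4$; $k\le k'$ implies $\Gamma_2(k)\le\Gamma_2(k')$. A rate of metastability for $(x_n)$ is a functional $M:(0,+\infty)\times\mathbb{N}^{\mathbb{N}}\to\mathbb{N}$ such that for all $\varepsilon>0$ and $f:\mathbb{N}\to\mathbb{N}$ there is $n\le M(\varepsilon,f)$ with $\|x_i-x_j\|\le\varepsilon$ for all $i,j\in[n,f(n)]$, where $[n,m]=\{n,n+1,\dots,m\}$ (empty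 if $m<n$). $\lceil x\rceil$ denotes the maximum of $0$ and the usual ceiling of $x$. Definition of $\mu[N,\gamma',\Gamma_1,\Gamma_2,\Gamma_3,\Gamma_4]$ for $\gamma'\in(0,1)$ (above it is used with $\gamma'=\gamma/2$). For $\varepsilon>0$: $V(\varepsilon):=\max\{\Gamma_3(\tfrac{\varepsilon}{4N}),\Gamma_4(\tfrac{\varepsilon}{4N})\}$; $\theta_1(\varepsilon):=\Gamma_2\big(V(\tfrac{\varepsilon}{2})+\lceil\ln(\tfrac{4N}{\varepsilon})\rceil+2\big)+1$; $\theta_3(\varepsilon):=\max\{\theta_1(\tfrac{(\gamma'\varepsilon)^2}{8N}),\Gamma_1(\tfrac{(\gamma'\varepsilon)^2}{2N^2})\}$; $\theta_4(\varepsilon):=\max\{\theta_1(\tfrac\varepsilon2),\theta_3(\tfrac\varepsilon2)\}$; $\rho_2(\varepsilon):=2\theta_3(\tfrac\varepsilon3)+2$; $\rho_3(\varepsilon):=2\max\{\theta_4(\tfrac\varepsilon6),\Gamma_1(\tfrac{\varepsilon}{4N})\}+1$; $\rho(\varepsilon):=\max\{\rho_2(\varepsilon),\rho_3(\varepsilon)\}$. For $h:(0,1]\to(0,1]$: $\varphi(\varepsilon,h):=\min\{h^{(i)}(1):0\le i\le\lceil\tfrac{N^2}{4\varepsilon}\rceil\}$ ($h^{(i)}$ the $i$-fold iterate), and $\Phi(\varepsilon,h):=\tfrac{1}{24N}\,\varphi(\tfrac{\varepsilon^2}{4N^2},\tilde h)^2$ with $\tilde h(\xi):=\min\{h(\tfrac{\xi^2}{24N}),\tfrac{\xi^2}{24N}\}$.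 For $\Delta:\mathbb{N}\to(0,1]$: $\Psi(\varepsilon,\Delta):=\rho(\Phi(\varepsilon,\overline\Delta))$ with $\overline\Delta(\eta):=\Delta(\rho(\eta))$ for $\eta\in(0,1]$. For given $\varepsilon>0$, $f:\mathbb{N}\to\mathbb{N}$: $\tilde\varepsilon:=\tfrac{\varepsilon^2}{16}$; $K(n):=\max\{n,\rho_3(\tfrac{\tilde\varepsilon}{36N})\}$; $\Sigma(n):=\Gamma_2\big(K(n)+\lceil\ln(\tfrac{12N^2}{\tilde\varepsilon})\rceil\big)+1$; $P(n):=f\big(2\max\{\Sigma(n),\theta_4(\tfrac\varepsilon4)\}+1\big)$; $\Delta_{\varepsilon,f}(n):=\min\{\tfrac{\tilde\varepsilon}{30N(P(n)+1)},1\}$; and $$\mu(\varepsilon,f):=2\max\{\Sigma(\Psi(\tfrac{\tilde\varepsilon}{24},\Delta_{\varepsilon,f})),\theta_4(\tfrac\varepsilon4)\}+1.$$ *)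

theory Defs
  imports "HOL-Analysis.Analysis"
begin

section \<open>Multi-valued operators on a Hilbert space\<close>

definition op_graph :: "('a \<Rightarrow> 'b set) \<Rightarrow> ('a \<times> 'b) set" where
  "op_graph A = {(x, y). y \<in> A x}"

definition monotone_op :: "('a::real_inner \<Rightarrow> 'a set) \<Rightarrow> bool" where
  "monotone_op A \<longleftrightarrow>
     (\<forall>(x, y) \<in> op_graph A. \<forall>(x', y') \<in> op_graph A. 0 \<le> (x - x') \<bullet> (y - y'))"

definition maximal_monotone_op :: "('a::real_inner \<Rightarrow> 'a set) \<Rightarrow> bool" where
  "maximal_monotone_op A \<longleftrightarrow>
     monotone_op A \<and> \<not> (\<exists>B. monotone_op B \<and> op_graph A \<subset> op_graph B)"

definition cocoercive :: "real \<Rightarrow> ('a::real_inner \<Rightarrow> 'a) \<Rightarrow> bool" where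
  "cocoercive \<delta> U \<longleftrightarrow> (\<forall>x y. (x - y) \<bullet> (U x - U y) \<ge> \<delta> * (norm (U x - U y))\<^sup>2)"

definition single_op :: "('a \<Rightarrow> 'b) \<Rightarrow> 'a \<Rightarrow> 'b set" where
  "single_op f = (\<lambda>x. {f x})"

text \<open>The sum of two values is their Minkowski sum (from Set_Algebras).\<close>

definition op_sum :: "('a \<Rightarrow> 'b::plus set) \<Rightarrow> ('a \<Rightarrow> 'b set) \<Rightarrow> 'a \<Rightarrow> 'b set" where
  "op_sum A B = (\<lambda>x. A x + B x)"

definition op_scale :: "real \<Rightarrow> ('a \<Rightarrow> 'b::real_vector set) \<Rightarrow> 'a \<Rightarrow> 'b set" where
  "op_scale c A = (\<lambda>x. (\<lambda>v. c *\<^sub>R v) ` A x)"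

definition op_inverse :: "('a \<Rightarrow> 'b set) \<Rightarrow> 'b \<Rightarrow> 'a set" where
  "op_inverse A = (\<lambda>y. {x. y \<in> A x})"

definition zer :: "('a \<Rightarrow> 'b::zero set) \<Rightarrow> 'a set" where
  "zer A = {x. 0 \<in> A x}"

text \<open>
  The resolvent as a function. For maximal monotone operators and positive parameters
  the inverse is single-valued and everywhere defined (Minty); otherwise the value is
  unspecified where the inverse is not a singleton.
\<close>

definition resolvent :: "real \<Rightarrow> ('a::real_inner \<Rightarrow> 'a set) \<Rightarrow> 'a \<Rightarrow> 'a" where
  "resolvent c A x = the_elem (op_inverse (op_sum (single_op id) (op_scale c A)) x)"

text \<open>
  The constant closest_point of HOL-Analysis is restricted to spaces with the
  Heine-Borel property, hence to finite dimension.
\<close>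

definition metric_proj :: "'a::real_inner set \<Rightarrow> 'a \<Rightarrow> 'a" where
  "metric_proj S a = (THE p. p \<in> S \<and> (\<forall>y\<in>S. norm (a - p) \<le> norm (a - y)))"

section \<open>Rates of metastability\<close>

text \<open>
  Functions on the positive reals are rendered as functions on all reals; only their
  values at positive arguments are ever constrained or used.
\<close>

definition rate_of_metastability ::
    "(real \<Rightarrow> (nat \<Rightarrow> nat) \<Rightarrow> nat) \<Rightarrow> (nat \<Rightarrow> 'a::real_normed_vector) \<Rightarrow> bool" where
  "rate_of_metastability M x \<longleftrightarrow>
     (\<forall>\<epsilon>>0. \<forall>f. \<exists>n \<le> M \<epsilon> f. \<forall>i\<in>{n..f n}. \<forall>j\<in>{n..f n}. norm (x i - x j) \<le> \<epsilon>)"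

text \<open>
  The conversion \<open>nat \<lceil>x\<rceil>\<close> is the maximum of 0 and the ceiling of x. The parameter
  \<open>g\<close> below is the constant in (0,1) on which the functional depends.
\<close>

context
  fixes N :: nat and g :: real
    and \<Gamma>1 :: "real \<Rightarrow> nat" and \<Gamma>2 :: "nat \<Rightarrow> nat"
    and \<Gamma>3 :: "real \<Rightarrow> nat" and \<Gamma>4 :: "real \<Rightarrow> nat"
begin

definition ms_V :: "real \<Rightarrow> nat" where
  "ms_V \<epsilon> = max (\<Gamma>3 (\<epsilon> / (4 * real N))) (\<Gamma>4 (\<epsilon> / (4 * real N)))"

definition ms_theta1 :: "real \<Rightarrow> nat" where
  "ms_theta1 \<epsilon> = \<Gamma>2 (ms_V (\<epsilon> / 2) + nat \<lceil>ln (4 * real N / \<epsilon>)\<rceil> + 2) + 1"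

definition ms_theta3 :: "real \<Rightarrow> nat" where
  "ms_theta3 \<epsilon> =
     max (ms_theta1 ((g * \<epsilon>)\<^sup>2 / (8 * real N))) (\<Gamma>1 ((g * \<epsilon>)\<^sup>2 / (2 * (real N)\<^sup>2)))"

definition ms_theta4 :: "real \<Rightarrow> nat" where
  "ms_theta4 \<epsilon> = max (ms_theta1 (\<epsilon> / 2)) (ms_theta3 (\<epsilon> / 2))"

definition ms_rho2 :: "real \<Rightarrow> nat" where
  "ms_rho2 \<epsilon> = 2 * ms_theta3 (\<epsilon> / 3) + 2"

definition ms_rho3 :: "real \<Rightarrow> nat" where
  "ms_rho3 \<epsilon> = 2 * max (ms_theta4 (\<epsilon> / 6)) (\<Gamma>1 (\<epsilon> / (4 * real N))) + 1"

definition ms_rho :: "real \<Rightarrow> nat" where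
  "ms_rho \<epsilon> = max (ms_rho2 \<epsilon>) (ms_rho3 \<epsilon>)"

definition ms_phi :: "real \<Rightarrow> (real \<Rightarrow> real) \<Rightarrow> real" where
  "ms_phi \<epsilon> h = Min ((\<lambda>i. (h ^^ i) 1) ` {0..nat \<lceil>(real N)\<^sup>2 / (4 * \<epsilon>)\<rceil>})"

definition ms_h_tilde :: "(real \<Rightarrow> real) \<Rightarrow> real \<Rightarrow> real" where
  "ms_h_tilde h \<xi> = min (h (\<xi>\<^sup>2 / (24 * real N))) (\<xi>\<^sup>2 / (24 * real N))"

definition ms_Phi :: "real \<Rightarrow> (real \<Rightarrow> real) \<Rightarrow> real" where
  "ms_Phi \<epsilon> h = 1 / (24 * real N) * (ms_phi (\<epsilon>\<^sup>2 / (4 * (real N)\<^sup>2)) (ms_h_tilde h))\<^sup>2"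

definition ms_Psi :: "real \<Rightarrow> (nat \<Rightarrow> real) \<Rightarrow> nat" where
  "ms_Psi \<epsilon> \<Delta> = ms_rho (ms_Phi \<epsilon> (\<lambda>\<eta>. \<Delta> (ms_rho \<eta>)))"

definition ms_eps_tilde :: "real \<Rightarrow> real" where
  "ms_eps_tilde \<epsilon> = \<epsilon>\<^sup>2 / 16"

definition ms_K :: "real \<Rightarrow> nat \<Rightarrow> nat" where
  "ms_K \<epsilon> n = max n (ms_rho3 (ms_eps_tilde \<epsilon> / (36 * real N)))"

definition ms_Sigma :: "real \<Rightarrow> nat \<Rightarrow> nat" where
  "ms_Sigma \<epsilon> n = \<Gamma>2 (ms_K \<epsilon> n + nat \<lceil>ln (12 * (real N)\<^sup>2 / ms_eps_tilde \<epsilon>)\<rceil>) + 1"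

definition ms_P :: "real \<Rightarrow> (nat \<Rightarrow> nat) \<Rightarrow> nat \<Rightarrow> nat" where
  "ms_P \<epsilon> f n = f (2 * max (ms_Sigma \<epsilon> n) (ms_theta4 (\<epsilon> / 4)) + 1)"

definition ms_Delta :: "real \<Rightarrow> (nat \<Rightarrow> nat) \<Rightarrow> nat \<Rightarrow> real" where
  "ms_Delta \<epsilon> f n = min (ms_eps_tilde \<epsilon> / (30 * real N * (real (ms_P \<epsilon> f n) + 1))) 1"

definition ms_mu :: "real \<Rightarrow> (nat \<Rightarrow> nat) \<Rightarrow> nat" where
  "ms_mu \<epsilon> f =
     2 * max (ms_Sigma \<epsilon> (ms_Psi (ms_eps_tilde \<epsilon> / 24) (ms_Delta \<epsilon> f))) (ms_theta4 (\<epsilon> / 4)) + 1"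

end

end

theory Submission
  imports Defs
begin

text \<open>
  The forward-backward operator \<open>F y = resolvent c U1 (y - c U2 y)\<close> is averaged, so that
  \<open>T = (1 - \<kappa>) Id + \<kappa> F\<close> is still nonexpansive for \<open>\<kappa> = (4 * \<delta> - c) / (2 * \<delta>)\<close>
  (\<open>forward_backward_relaxation_nonexpansive\<close>), and its fixed points are the zeros of the sum. That
  the resolvent is defined everywhere is Minty's theorem, obtained here by minimising the Fitzpatrick
  function plus half the squared norm
  (\<open>maximal_monotone_graph_meets_antidiagonal\<close>). Rewritten in terms of \<open>T\<close>, the scheme alternates
  a Halpern step towards \<open>u\<close> with a Mann step for \<open>T\<close>, and the quantitative part is about such iterations.

  For such an iteration, the summable variation of the parameters and the divergence of the series of
  the \<open>\<alpha> n\<close> make consecutive even iterates close (\<open>even_differences_small\<close>); strict convexity of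
  the squared norm turns this into asymptotic regularity, \<open>T (x m) - x m \<longlonglongrightarrow> 0\<close>, with an explicit rate
  (\<open>displacement_small\<close>). The classical argument would now compare with the projection \<open>z\<close> of \<open>u\<close>
  onto the fixed point set: the variational inequality \<open>(u - z) \<bullet> (y - z) \<le> 0\<close> makes the squared
  distances to \<open>z\<close> satisfy a contractive recursion with vanishing error. The projection itself is not
  computable, but on a finite interval of indices an approximate one is enough. It is found by a
  bounded descent (\<open>approximate_projection\<close>), and it can be made a fixed point up to any precision that
  depends on the set of competitors it is tested against. Choosing this precision according
  to the length of the interval gives the rate of metastability
  (\<open>iterates_near_approximate_projection\<close>).

  A metastable sequence is Cauchy. Its limit is a fixed point, and it satisfies the exact variational
  inequality because otherwise the squared distances to some fixed point would decrease
  by a non-summable amount (\<open>limit_variational_inequality\<close>); this characterises the projection.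
\<close>

section \<open>Strongly convex minimisation and Minty's theorem\<close>

lemma norm_sq_convex_combination:
  fixes a b p :: "'a::real_inner"
  shows "(norm ((1 - t) *\<^sub>R a + t *\<^sub>R b - p))\<^sup>2
    = (1 - t) * (norm (a - p))\<^sup>2 + t * (norm (b - p))\<^sup>2 - t * (1 - t) * (norm (a - b))\<^sup>2"
  by (simp add: power2_norm_eq_inner inner_simps inner_commute algebra_simps)

text \<open>
  This is the minimisation of a proper, convex, lower semicontinuous function plus
  \<open>z \<mapsto> (norm z)\<^sup>2 / 2\<close>, with the function given by its epigraph \<open>E\<close>, so that infinite values need
  no special treatment. Strong convexity makes every minimising sequence Cauchy. The
  conclusion is the optimality condition: minus the minimiser is a subgradient at the minimiser.
\<close>

lemma quadratic_perturbation_attains_min: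
  fixes E :: "('b::{real_inner,complete_space} \<times> real) set"
  assumes closed: "closed E" and convex: "convex E" and nonempty: "E \<noteq> {}"
    and bounded: "\<And>z r. (z, r) \<in> E \<Longrightarrow> 0 \<le> r + (norm z)\<^sup>2 / 2"
  obtains z0 r0 where "(z0, r0) \<in> E"
    and "\<And>z r. (z, r) \<in> E \<Longrightarrow> r0 + (norm z0)\<^sup>2 \<le> r + z0 \<bullet> z"
proof -
  define q where "q e = snd e + (norm (fst e))\<^sup>2 / 2" for e :: "'b \<times> real"
  define I where "I = Inf (q ` E)"
  have bdd: "bdd_below (q ` E)"
    using bounded by (intro bdd_belowI[of _ 0]) (auto simp: q_def)
  have I_le: "I \<le> q e" if "e \<in> E" for e
    unfolding I_def using that bdd by (intro cInf_lower) auto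
  have "\<exists>e\<in>E. q e < I + 1 / real (Suc n)" for n
  proof -
    have "Inf (q ` E) < I + 1 / real (Suc n)" by (simp add: I_def)
    then show ?thesis using cInf_lessD[of "q ` E"] nonempty by blast
  qed
  then obtain e where e: "\<And>n. e n \<in> E" "\<And>n. q (e n) < I + 1 / real (Suc n)" by metis
  have along_segment: "(1 - t) *\<^sub>R a + t *\<^sub>R b \<in> E"
    if "a \<in> E" "b \<in> E" "0 \<le> t" "t \<le> 1" for a b t
    using convexD_alt[OF convex that(1,2)] that(3,4) by simp
  have q_segment: "q ((1 - t) *\<^sub>R a + t *\<^sub>R b)
      = (1 - t) * q a + t * q b - t * (1 - t) * (norm (fst a - fst b))\<^sup>2 / 2" for a b t
    using norm_sq_convex_combination[of t "fst a" "fst b" 0]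
    by (simp add: q_def algebra_simps add_divide_distrib diff_divide_distrib)
  have close: "(norm (fst (e m) - fst (e n)))\<^sup>2 \<le> 4 * (1 / real (Suc m) + 1 / real (Suc n))" for m n
  proof -
    have "I \<le> q ((1 - 1/2) *\<^sub>R e m + (1/2) *\<^sub>R e n)"
      by (intro I_le along_segment) (auto simp: e)
    also have "\<dots> = (q (e m) + q (e n)) / 2 - (norm (fst (e m) - fst (e n)))\<^sup>2 / 8"
      by (subst q_segment) (simp add: field_simps)
    finally show ?thesis using e(2)[of m] e(2)[of n] by argo
  qed
  have "Cauchy (\<lambda>n. fst (e n))"
  proof (rule metric_CauchyI)
    fix \<epsilon> :: real assume "0 < \<epsilon>"
    then have "0 < \<epsilon>\<^sup>2 / 8" by simp
    then obtain M where M: "inverse (real (Suc M)) < \<epsilon>\<^sup>2 / 8"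
      using reals_Archimedean by blast
    have "dist (fst (e m)) (fst (e n)) < \<epsilon>" if "m \<ge> M" "n \<ge> M" for m n
    proof -
      have "1 / real (Suc m) \<le> 1 / real (Suc M)" "1 / real (Suc n) \<le> 1 / real (Suc M)"
        using that by (auto intro!: divide_left_mono)
      then have "(norm (fst (e m) - fst (e n)))\<^sup>2 < \<epsilon>\<^sup>2"
        using close[of m n] M by (simp add: inverse_eq_divide)
      then show ?thesis using \<open>0 < \<epsilon>\<close> by (simp add: dist_norm power2_less_imp_less)
    qed
    then show "\<exists>M. \<forall>m\<ge>M. \<forall>n\<ge>M. dist (fst (e m)) (fst (e n)) < \<epsilon>" by blast
  qed
  then obtain z0 where z0: "(\<lambda>n. fst (e n)) \<longlonglongrightarrow> z0"
    using Cauchy_convergent_iff convergent_def by blast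
  have "(\<lambda>n. q (e n)) \<longlonglongrightarrow> I"
  proof (rule tendsto_sandwich)
    show "(\<lambda>n. I) \<longlonglongrightarrow> I" by simp
    show "(\<lambda>n. I + 1 / real (Suc n)) \<longlonglongrightarrow> I"
      using LIMSEQ_inverse_real_of_nat_add[of I] by (simp add: inverse_eq_divide)
    show "\<forall>\<^sub>F n in sequentially. I \<le> q (e n)" using I_le e(1) by simp
    show "\<forall>\<^sub>F n in sequentially. q (e n) \<le> I + 1 / real (Suc n)"
      using e(2) by (simp add: less_imp_le)
  qed
  then have "(\<lambda>n. q (e n) - (norm (fst (e n)))\<^sup>2 / 2) \<longlonglongrightarrow> I - (norm z0)\<^sup>2 / 2"
    by (intro tendsto_intros z0) auto
  then have "(\<lambda>n. snd (e n)) \<longlonglongrightarrow> I - (norm z0)\<^sup>2 / 2" by (simp add: q_def)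
  from tendsto_Pair[OF z0 this] have "e \<longlonglongrightarrow> (z0, I - (norm z0)\<^sup>2 / 2)" by simp
  then have in_E: "(z0, I - (norm z0)\<^sup>2 / 2) \<in> E"
    using closed e(1) by (meson closed_sequentially)
  moreover have "I - (norm z0)\<^sup>2 / 2 + (norm z0)\<^sup>2 \<le> r + z0 \<bullet> z" if zr: "(z, r) \<in> E" for z r
  proof -
    define a where "a = q (z, r) - I"
    define b where "b = (norm (z0 - z))\<^sup>2 / 2"
    have slope: "0 \<le> a - (1 - t) * b" if t: "0 < t" "t \<le> 1" for t
    proof -
      have "I \<le> q ((1 - t) *\<^sub>R (z0, I - (norm z0)\<^sup>2 / 2) + t *\<^sub>R (z, r))"
        using t by (intro I_le along_segment in_E zr) auto
      also have "\<dots> = I + t * (a - (1 - t) * b)"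
        by (subst q_segment) (simp add: a_def b_def q_def field_simps)
      finally have "0 \<le> t * (a - (1 - t) * b)" by simp
      then show ?thesis using t by (simp add: zero_le_mult_iff)
    qed
    have "\<forall>\<^sub>F n in sequentially. 0 \<le> a - (1 - 1 / real (Suc n)) * b"
      by (intro always_eventually allI slope) auto
    moreover have "(\<lambda>n. a - (1 - 1 / real (Suc n)) * b) \<longlonglongrightarrow> a - (1 - 0) * b"
      using LIMSEQ_inverse_real_of_nat
      by (intro tendsto_intros) (simp add: inverse_eq_divide)
    ultimately have "0 \<le> a - b"
      using tendsto_lowerbound by fastforce
    then show ?thesis
      unfolding a_def b_def q_def
      by (simp add: power2_norm_eq_inner inner_simps inner_commute)
  qed
  ultimately show thesis by (rule that)
qed

text \<open>
  Minty's theorem, in the form that \<open>Id + A\<close> takes the value 0. The set \<open>E\<close> is the epigraph of the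
  Fitzpatrick function of the graph, \<open>F (x, y) = sup {x \<bullet> b + a \<bullet> y - a \<bullet> b | (a, b) \<in> G}\<close>.
  Maximality gives \<open>F (x, y) \<ge> x \<bullet> y\<close>, monotonicity gives \<open>F (a, b) = a \<bullet> b\<close> on the graph. At the
  minimiser \<open>(x0, y0)\<close> of \<open>F\<close> plus half the squared norm, the optimality condition tested at points of
  the graph says that \<open>(- y0, - x0)\<close> is monotonically related to the whole graph, hence belongs to it;
  tested at this very point it forces \<open>y0 = - x0\<close>.
\<close>

lemma maximal_monotone_graph_meets_antidiagonal:
  fixes G :: "('a::{real_inner,complete_space} \<times> 'a) set"
  assumes mono: "\<And>a b a' b'. (a, b) \<in> G \<Longrightarrow> (a', b') \<in> G \<Longrightarrow> 0 \<le> (a - a') \<bullet> (b - b')"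
    and max: "\<And>x y. (\<And>a b. (a, b) \<in> G \<Longrightarrow> 0 \<le> (x - a) \<bullet> (y - b)) \<Longrightarrow> (x, y) \<in> G"
  shows "\<exists>x. (x, - x) \<in> G"
proof -
  define E where "E = {(z, r). \<forall>(a, b)\<in>G. fst z \<bullet> b + a \<bullet> snd z - a \<bullet> b \<le> r}"
  have E_eq: "E = (\<Inter>(a, b)\<in>G. {e. (b, a) \<bullet> fst e - a \<bullet> b \<le> snd e})"
    by (auto simp: E_def inner_prod_def inner_commute)
  have fitzpatrick_ge: "x \<bullet> y \<le> r" if "((x, y), r) \<in> E" for x y r
  proof (rule ccontr)
    assume less: "\<not> x \<bullet> y \<le> r"
    have pos: "0 < (x - a) \<bullet> (y - b)" if "(a, b) \<in> G" for a b
    proof -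
      have "x \<bullet> b + a \<bullet> y - a \<bullet> b \<le> r" using that \<open>((x, y), r) \<in> E\<close> by (auto simp: E_def)
      then show ?thesis using less by (simp add: inner_simps)
    qed
    then have "(x, y) \<in> G" by (intro max) (simp add: less_imp_le)
    from pos[OF this] show False by simp
  qed
  have on_graph: "((a, b), a \<bullet> b) \<in> E" if "(a, b) \<in> G" for a b
    unfolding E_def using mono[OF that] by (fastforce simp: inner_simps)
  have closed: "closed E"
    unfolding E_eq by (intro closed_INT ballI) (auto intro!: closed_Collect_le continuous_intros)
  have convex: "convex E"
  proof (rule convexI)
    fix e e' :: "('a \<times> 'a) \<times> real" and s t :: real
    assume *: "e \<in> E" "e' \<in> E" "0 \<le> s" "0 \<le> t" "s + t = 1"
    have "(b, a) \<bullet> fst (s *\<^sub>R e + t *\<^sub>R e') - a \<bullet> b \<le> snd (s *\<^sub>R e + t *\<^sub>R e')" if "(a, b) \<in> G" for a b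
    proof -
      have "(b, a) \<bullet> fst e - a \<bullet> b \<le> snd e" "(b, a) \<bullet> fst e' - a \<bullet> b \<le> snd e'"
        using * that by (auto simp: E_eq)
      then have "s * ((b, a) \<bullet> fst e - a \<bullet> b) + t * ((b, a) \<bullet> fst e' - a \<bullet> b)
          \<le> s * snd e + t * snd e'"
        using * by (intro add_mono mult_left_mono) auto
      moreover have "s * (a \<bullet> b) + t * (a \<bullet> b) = a \<bullet> b"
        using * by (simp flip: distrib_right)
      ultimately show ?thesis
        by (simp add: inner_add_right right_diff_distrib)
    qed
    then show "s *\<^sub>R e + t *\<^sub>R e' \<in> E" by (auto simp: E_eq)
  qed
  have nonempty: "E \<noteq> {}"
  proof -
    have "G \<noteq> {}" using max by blast
    then show ?thesis using on_graph by fast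
  qed
  have bounded: "0 \<le> r + (norm z)\<^sup>2 / 2" if "(z, r) \<in> E" for z r
  proof -
    obtain x y where z: "z = (x, y)" by (cases z)
    have "0 \<le> (norm (x + y))\<^sup>2" by simp
    then show ?thesis using fitzpatrick_ge[of x y r] that
      by (simp add: z power2_norm_eq_inner inner_simps inner_commute field_simps)
  qed
  obtain z0 r0 where min_in: "(z0, r0) \<in> E"
    and min: "\<And>z r. (z, r) \<in> E \<Longrightarrow> r0 + (norm z0)\<^sup>2 \<le> r + z0 \<bullet> z"
    using quadratic_perturbation_attains_min[OF closed convex nonempty bounded] by blast
  obtain x0 y0 where z0: "z0 = (x0, y0)" by (cases z0)
  have test: "(norm (x0 + y0))\<^sup>2 \<le> (- y0 - a) \<bullet> (- x0 - b)" if "(a, b) \<in> G" for a b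
    using min[OF on_graph[OF that]] fitzpatrick_ge[of x0 y0 r0] min_in
    by (simp add: z0 power2_norm_eq_inner inner_simps inner_commute)
  have in_graph: "(- y0, - x0) \<in> G"
    using test by (intro max) (meson order_trans zero_le_power2)
  then have "x0 + y0 = 0" using test by fastforce
  then have "- y0 = x0" by (simp add: add_eq_0_iff2)
  then show ?thesis using in_graph by auto
qed

section \<open>The forward-backward operator\<close>

lemma maximal_monotone_op_mem:
  assumes "maximal_monotone_op A"
    and related: "\<And>a b. b \<in> A a \<Longrightarrow> 0 \<le> (x - a) \<bullet> (y - b)"
  shows "y \<in> A x"
proof (rule ccontr)
  assume notin: "y \<notin> A x"
  define B where "B = A(x := insert y (A x))"
  have B: "b \<in> B a \<longleftrightarrow> b \<in> A a \<or> (a = x \<and> b = y)" for a b by (auto simp: B_def)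
  have "0 \<le> (a - a') \<bullet> (b - b')" if "b \<in> A a" "b' \<in> A a'" for a a' b b'
    using assms(1) that by (auto simp: maximal_monotone_op_def monotone_op_def op_graph_def)
  moreover have "0 \<le> (a - x) \<bullet> (b - y)" if "b \<in> A a" for a b
    using related[OF that] by (simp add: inner_simps)
  ultimately have "monotone_op B"
    using related by (auto simp: monotone_op_def op_graph_def B)
  moreover have "op_graph A \<subset> op_graph B"
    using notin by (auto simp: op_graph_def B)
  ultimately show False using assms(1) by (auto simp: maximal_monotone_op_def)
qed

lemma maximal_monotone_opD:
  assumes "maximal_monotone_op A" "b \<in> A a" "b' \<in> A a'"
  shows "0 \<le> (a - a') \<bullet> (b - b')"
  using assms by (auto simp: maximal_monotone_op_def monotone_op_def op_graph_def)

text \<open>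
  Everywhere-definedness of the resolvent is Minty's theorem for the maximal monotone operator
  \<open>\<lambda>a. c A a - w\<close>; single-valuedness is plain monotonicity.
\<close>

lemma resolvent_eq_iff:
  fixes A :: "'a::{real_inner,complete_space} \<Rightarrow> 'a set"
  assumes A: "maximal_monotone_op A" and c: "c > 0"
  shows "resolvent c A w = z \<longleftrightarrow> (1 / c) *\<^sub>R (w - z) \<in> A z"
proof -
  have inverse_iff: "y \<in> op_inverse (op_sum (single_op id) (op_scale c A)) w
      \<longleftrightarrow> (1 / c) *\<^sub>R (w - y) \<in> A y" for y
  proof -
    have "y \<in> op_inverse (op_sum (single_op id) (op_scale c A)) w
        \<longleftrightarrow> (\<exists>b\<in>A y. w = y + c *\<^sub>R b)"
      by (auto simp: op_inverse_def op_sum_def single_op_def op_scale_def set_plus_def)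
    also have "\<dots> \<longleftrightarrow> (1 / c) *\<^sub>R (w - y) \<in> A y"
      using c by (auto intro!: bexI[of _ "(1 / c) *\<^sub>R (w - y)"])
    finally show ?thesis .
  qed
  define G where "G = {(a, v). (1 / c) *\<^sub>R (w + v) \<in> A a}"
  have "\<exists>y. (y, - y) \<in> G"
  proof (rule maximal_monotone_graph_meets_antidiagonal)
    fix a b a' b' assume "(a, b) \<in> G" "(a', b') \<in> G"
    then have "0 \<le> (a - a') \<bullet> ((1 / c) *\<^sub>R (w + b) - (1 / c) *\<^sub>R (w + b'))"
      unfolding G_def using maximal_monotone_opD[OF A] by blast
    also have "\<dots> = (1 / c) * ((a - a') \<bullet> (b - b'))"
      by (simp add: inner_simps algebra_simps)
    finally show "0 \<le> (a - a') \<bullet> (b - b')" using c by (simp add: zero_le_divide_iff)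
  next
    fix x y assume related: "\<And>a b. (a, b) \<in> G \<Longrightarrow> 0 \<le> (x - a) \<bullet> (y - b)"
    have "(1 / c) *\<^sub>R (w + y) \<in> A x"
    proof (rule maximal_monotone_op_mem[OF A])
      fix a b assume "b \<in> A a"
      then have "(a, c *\<^sub>R b - w) \<in> G" using c by (simp add: G_def)
      then have "0 \<le> (1 / c) * ((x - a) \<bullet> (y - (c *\<^sub>R b - w)))"
        using related c by simp
      also have "\<dots> = (x - a) \<bullet> ((1 / c) *\<^sub>R (w + y) - b)"
        using c by (simp add: inner_simps field_simps)
      finally show "0 \<le> (x - a) \<bullet> ((1 / c) *\<^sub>R (w + y) - b)" .
    qed
    then show "(x, y) \<in> G" by (simp add: G_def)
  qed
  then obtain y where y: "(1 / c) *\<^sub>R (w - y) \<in> A y" by (auto simp: G_def)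
  have unique: "y' = y" if "(1 / c) *\<^sub>R (w - y') \<in> A y'" for y'
  proof -
    have "0 \<le> (y' - y) \<bullet> ((1 / c) *\<^sub>R (w - y') - (1 / c) *\<^sub>R (w - y))"
      using that y maximal_monotone_opD[OF A] by blast
    also have "\<dots> = - (1 / c) * (norm (y' - y))\<^sup>2"
      by (simp add: power2_norm_eq_inner inner_simps inner_commute algebra_simps)
    finally have "(norm (y' - y))\<^sup>2 \<le> 0" using c by (simp add: divide_le_0_iff)
    then show ?thesis by simp
  qed
  have "op_inverse (op_sum (single_op id) (op_scale c A)) w = {y}"
    using y unique inverse_iff by blast
  then have "resolvent c A w = y" by (simp add: resolvent_def)
  then show ?thesis using y unique by blast
qed

lemma resolvent_firmly_nonexpansive:
  fixes A :: "'a::{real_inner,complete_space} \<Rightarrow> 'a set"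
  assumes A: "maximal_monotone_op A" and c: "c > 0"
  shows "(norm (resolvent c A v - resolvent c A w))\<^sup>2
    \<le> (resolvent c A v - resolvent c A w) \<bullet> (v - w)"
proof -
  let ?p = "resolvent c A v" and ?q = "resolvent c A w"
  have "0 \<le> (?p - ?q) \<bullet> ((1 / c) *\<^sub>R (v - ?p) - (1 / c) *\<^sub>R (w - ?q))"
    using resolvent_eq_iff[OF A c] by (intro maximal_monotone_opD[OF A]) auto
  also have "\<dots> = (1 / c) * ((?p - ?q) \<bullet> (v - w) - (norm (?p - ?q))\<^sup>2)"
    by (simp add: power2_norm_eq_inner inner_simps inner_commute algebra_simps)
  finally show ?thesis using c by (simp add: zero_le_divide_iff)
qed

lemma fixed_point_forward_backward_iff_zero:
  fixes A :: "'a::{real_inner,complete_space} \<Rightarrow> 'a set"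
  assumes A: "maximal_monotone_op A" and c: "c > 0"
  shows "resolvent c A (y - c *\<^sub>R U y) = y \<longleftrightarrow> y \<in> zer (op_sum A (single_op U))"
proof -
  have "y \<in> zer (op_sum A (single_op U)) \<longleftrightarrow> - U y \<in> A y"
  proof -
    have "y \<in> zer (op_sum A (single_op U)) \<longleftrightarrow> (\<exists>a\<in>A y. 0 = a + U y)"
      by (simp add: zer_def op_sum_def single_op_def set_plus_def)
    also have "\<dots> \<longleftrightarrow> - U y \<in> A y"
      by (metis add.left_inverse add_eq_0_iff2)
    finally show ?thesis .
  qed
  then show ?thesis using c by (simp add: resolvent_eq_iff[OF A c])
qed

text \<open>
  The forward-backward operator is averaged with constant \<open>1 / \<kappa>\<close>, \<open>\<kappa> = 2 - s\<close> and
  \<open>s = c / (2 * \<delta>)\<close>. With \<open>t\<close>, \<open>d\<close>, \<open>e\<close> the differences of the values of the operator, of the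
  arguments and of \<open>U\<close>, firm nonexpansiveness of the resolvent and cocoercivity bound
  \<open>(norm (\<kappa> t + (1 - \<kappa>) d))\<^sup>2 - (norm d)\<^sup>2\<close> by \<open>- \<kappa> s (norm (t - d + (c / s) e))\<^sup>2\<close>.
\<close>

lemma forward_backward_relaxation_nonexpansive:
  fixes A :: "'a::{real_inner,complete_space} \<Rightarrow> 'a set"
  assumes A: "maximal_monotone_op A" and \<delta>: "\<delta> > 0" and U: "cocoercive \<delta> U"
    and c: "0 < c" "c \<le> 2 * \<delta>"
    and F: "\<And>y. F y = resolvent c A (y - c *\<^sub>R U y)"
    and \<kappa>: "\<kappa> = (4 * \<delta> - c) / (2 * \<delta>)"
  shows "norm (((1 - \<kappa>) *\<^sub>R y + \<kappa> *\<^sub>R F y) - ((1 - \<kappa>) *\<^sub>R z + \<kappa> *\<^sub>R F z)) \<le> norm (y - z)"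
proof -
  define t d e where "t = F y - F z" and "d = y - z" and "e = U y - U z"
  define s where "s = c / (2 * \<delta>)"
  have s: "s > 0" "s * (c / s) = c" "s * (c / s)\<^sup>2 = 2 * \<delta> * c"
    using c \<delta> by (simp_all add: s_def power2_eq_square field_simps)
  have \<kappa>_s: "\<kappa> = 2 - s" using \<delta> by (simp add: \<kappa> s_def field_simps)
  have \<kappa>_pos: "\<kappa> > 0" using c \<delta> by (simp add: \<kappa>)
  have firm: "t \<bullet> t \<le> t \<bullet> d - c * (t \<bullet> e)"
    using resolvent_firmly_nonexpansive[OF A c(1), of "y - c *\<^sub>R U y" "z - c *\<^sub>R U z"]
    by (simp add: t_def d_def e_def F power2_norm_eq_inner inner_diff_right)
       (simp add: algebra_simps)
  have "\<delta> * (e \<bullet> e) \<le> d \<bullet> e"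
    using U by (simp add: cocoercive_def e_def d_def power2_norm_eq_inner)
  then have coc: "2 * c * (\<delta> * (e \<bullet> e)) \<le> 2 * c * (d \<bullet> e)" using c by simp
  have "s * ((t - d + (c / s) *\<^sub>R e) \<bullet> (t - d + (c / s) *\<^sub>R e))
      = s * ((t - d) \<bullet> (t - d)) + 2 * (s * (c / s)) * ((t - d) \<bullet> e) + s * (c / s)\<^sup>2 * (e \<bullet> e)"
    by (simp add: inner_add_left inner_add_right inner_commute power2_eq_square algebra_simps)
  moreover have "0 \<le> s * ((t - d + (c / s) *\<^sub>R e) \<bullet> (t - d + (c / s) *\<^sub>R e))"
    using s by simp
  ultimately have square: "0 \<le> s * ((t - d) \<bullet> (t - d)) + 2 * c * ((t - d) \<bullet> e) + 2 * \<delta> * c * (e \<bullet> e)"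
    using s by simp
  have "\<kappa> * (t \<bullet> t) + 2 * (1 - \<kappa>) * (t \<bullet> d) - (2 - \<kappa>) * (d \<bullet> d) \<le> 0"
    using firm coc square
    by (simp add: \<kappa>_s inner_diff_left inner_diff_right inner_commute algebra_simps)
  then have "\<kappa> * (\<kappa> * (t \<bullet> t) + 2 * (1 - \<kappa>) * (t \<bullet> d) - (2 - \<kappa>) * (d \<bullet> d)) \<le> 0"
    using \<kappa>_pos by (simp add: mult_le_0_iff)
  moreover have "((1 - \<kappa>) *\<^sub>R d + \<kappa> *\<^sub>R t) \<bullet> ((1 - \<kappa>) *\<^sub>R d + \<kappa> *\<^sub>R t) - d \<bullet> d
      = \<kappa> * (\<kappa> * (t \<bullet> t) + 2 * (1 - \<kappa>) * (t \<bullet> d) - (2 - \<kappa>) * (d \<bullet> d))"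
    by (simp add: inner_add_left inner_add_right inner_commute algebra_simps)
  ultimately have "(norm ((1 - \<kappa>) *\<^sub>R d + \<kappa> *\<^sub>R t))\<^sup>2 \<le> (norm d)\<^sup>2"
    by (simp add: power2_norm_eq_inner)
  then have "norm ((1 - \<kappa>) *\<^sub>R d + \<kappa> *\<^sub>R t) \<le> norm d"
    using power2_le_imp_le by fastforce
  moreover have "((1 - \<kappa>) *\<^sub>R y + \<kappa> *\<^sub>R F y) - ((1 - \<kappa>) *\<^sub>R z + \<kappa> *\<^sub>R F z)
      = (1 - \<kappa>) *\<^sub>R d + \<kappa> *\<^sub>R t"
    by (simp add: d_def t_def algebra_simps)
  ultimately show ?thesis by (simp add: d_def)
qed

section \<open>Nearly fixed points of nonexpansive maps\<close>

text \<open>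
  The fixed point set of a nonexpansive map is convex; quantitatively, two points
  that are fixed up to \<open>\<delta>\<close> span a segment of points that are fixed up to the order of \<open>sqrt \<delta>\<close>.
  The point \<open>T w\<close> is almost as close to both endpoints as \<open>w\<close>, and in an inner product space two
  such points must be close to each other.
\<close>

lemma nonexpansive_segment_nearly_fixed:
  fixes T :: "'a::real_inner \<Rightarrow> 'a"
  assumes nonexp: "\<And>y z. norm (T y - T z) \<le> norm (y - z)"
    and a: "norm (T a - a) \<le> \<delta>" and b: "norm (T b - b) \<le> \<delta>"
    and t: "0 \<le> t" "t \<le> 1"
  shows "(norm (T ((1 - t) *\<^sub>R a + t *\<^sub>R b) - ((1 - t) *\<^sub>R a + t *\<^sub>R b)))\<^sup>2
    \<le> norm (a - b) * \<delta> + \<delta>\<^sup>2"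
proof -
  define w where "w = (1 - t) *\<^sub>R a + t *\<^sub>R b"
  define d where "d = norm (a - b)"
  have \<delta>: "0 \<le> \<delta>" using a norm_ge_zero order_trans by blast
  have "w - a = t *\<^sub>R (b - a)" "w - b = (1 - t) *\<^sub>R (a - b)"
    by (simp_all add: w_def algebra_simps)
  then have wa: "norm (w - a) = t * d" and wb: "norm (w - b) = (1 - t) * d"
    using t by (simp_all add: d_def norm_minus_commute)
  have "norm (a - T w) \<le> norm (T w - T a) + norm (T a - a)"
    using norm_triangle_ineq[of "T w - T a" "T a - a"] by (simp add: norm_minus_commute)
  then have Ta: "norm (a - T w) \<le> t * d + \<delta>" using nonexp[of w a] a wa by linarith
  have "norm (b - T w) \<le> norm (T w - T b) + norm (T b - b)"
    using norm_triangle_ineq[of "T w - T b" "T b - b"] by (simp add: norm_minus_commute)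
  then have Tb: "norm (b - T w) \<le> (1 - t) * d + \<delta>" using nonexp[of w b] b wb by linarith
  have "(norm (w - T w))\<^sup>2
      = (1 - t) * (norm (a - T w))\<^sup>2 + t * (norm (b - T w))\<^sup>2 - t * (1 - t) * d\<^sup>2"
    unfolding w_def d_def by (rule norm_sq_convex_combination)
  also have "\<dots> \<le> (1 - t) * (t * d + \<delta>)\<^sup>2 + t * ((1 - t) * d + \<delta>)\<^sup>2 - t * (1 - t) * d\<^sup>2"
    using t Ta Tb by (intro diff_right_mono add_mono mult_left_mono power_mono) auto
  also have "\<dots> = 4 * (t * (1 - t)) * (d * \<delta>) + \<delta>\<^sup>2"
    by (simp add: power2_eq_square algebra_simps)
  also have "\<dots> \<le> d * \<delta> + \<delta>\<^sup>2"
  proof -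
    have "0 \<le> (1 - 2 * t)\<^sup>2" by simp
    then have "4 * (t * (1 - t)) \<le> 1" by (simp add: power2_eq_square algebra_simps)
    then have "4 * (t * (1 - t)) * (d * \<delta>) \<le> 1 * (d * \<delta>)"
      using \<delta> by (intro mult_right_mono) (auto simp: d_def)
    then show ?thesis by simp
  qed
  finally show ?thesis by (simp add: w_def d_def norm_minus_commute)
qed

lemma iterate_in_unit_interval:
  fixes h :: "real \<Rightarrow> real"
  assumes "\<And>\<xi>. 0 < \<xi> \<Longrightarrow> \<xi> \<le> 1 \<Longrightarrow> 0 < h \<xi> \<and> h \<xi> \<le> 1"
  shows "0 < (h ^^ i) 1 \<and> (h ^^ i) 1 \<le> 1"
proof (induction i)
  case (Suc i)
  then show ?case using assms[of "(h ^^ i) 1"] by simp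
qed simp

lemma ms_phi_le: "i \<le> nat \<lceil>(real N)\<^sup>2 / (4 * \<epsilon>)\<rceil> \<Longrightarrow> ms_phi N \<epsilon> h \<le> (h ^^ i) 1"
  unfolding ms_phi_def by (intro Min_le) auto

lemma ms_phi_pos:
  assumes "\<And>\<xi>. 0 < \<xi> \<Longrightarrow> \<xi> \<le> 1 \<Longrightarrow> 0 < h \<xi> \<and> h \<xi> \<le> 1"
  shows "0 < ms_phi N \<epsilon> h"
proof -
  have "0 < (h ^^ i) 1" for i using iterate_in_unit_interval assms by blast
  then show ?thesis unfolding ms_phi_def by (subst Min_gr_iff) auto
qed

text \<open>
  The metric projection of \<open>u\<close> onto the fixed point set, with finite precision: \<open>z\<close> is fixed up to
  \<open>h \<xi>\<close> and is \<open>\<epsilon>\<close>-optimal among all points that are fixed up to \<open>\<xi>\<close>. If no level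
  \<open>\<xi> = (h ^^ i) 1\<close> worked, then starting from the fixed point \<open>p\<close> at the finest level one could move
  to coarser and coarser levels and gain \<open>\<epsilon>\<close> each time, which exhausts \<open>(norm (u - p))\<^sup>2\<close>.
\<close>

lemma approximate_projection:
  fixes T :: "'a::real_inner \<Rightarrow> 'a" and N :: nat
  assumes fixed: "T p = p" and u: "2 * norm (u - p) \<le> real N" and \<epsilon>: "\<epsilon> > 0"
    and h: "\<And>\<xi>. 0 < \<xi> \<Longrightarrow> \<xi> \<le> 1 \<Longrightarrow> 0 < h \<xi> \<and> h \<xi> \<le> 1"
  obtains \<xi> z where "ms_phi N \<epsilon> h \<le> \<xi>" "0 < \<xi>" "\<xi> \<le> 1"
    and "norm (z - p) \<le> real N" "norm (T z - z) \<le> h \<xi>"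
    and "\<And>y. norm (y - p) \<le> real N \<Longrightarrow> norm (T y - y) \<le> \<xi> \<Longrightarrow>
           (norm (u - z))\<^sup>2 \<le> (norm (u - y))\<^sup>2 + \<epsilon>"
proof -
  define k where "k = nat \<lceil>(real N)\<^sup>2 / (4 * \<epsilon>)\<rceil>"
  have "\<exists>i\<le>k. \<exists>z. norm (z - p) \<le> real N \<and> norm (T z - z) \<le> h ((h ^^ i) 1) \<and>
    (\<forall>y. norm (y - p) \<le> real N \<longrightarrow> norm (T y - y) \<le> (h ^^ i) 1 \<longrightarrow>
      (norm (u - z))\<^sup>2 \<le> (norm (u - y))\<^sup>2 + \<epsilon>)"
  proof (rule ccontr)
    assume *: "\<not> ?thesis"
    have improve: "\<exists>y. norm (y - p) \<le> real N \<and> norm (T y - y) \<le> (h ^^ i) 1 \<and>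
        (norm (u - y))\<^sup>2 + \<epsilon> < (norm (u - z))\<^sup>2"
      if "i \<le> k" "norm (z - p) \<le> real N" "norm (T z - z) \<le> h ((h ^^ i) 1)" for i z
      using * that by (meson not_le)
    have "\<exists>y. norm (y - p) \<le> real N \<and> norm (T y - y) \<le> (h ^^ (Suc k - j)) 1 \<and>
        (norm (u - y))\<^sup>2 \<le> (norm (u - p))\<^sup>2 - real j * \<epsilon>" if "j \<le> Suc k" for j
      using that
    proof (induction j)
      case 0
      have "0 < (h ^^ Suc k) 1" using iterate_in_unit_interval h by blast
      then show ?case using fixed by (intro exI[of _ p]) auto
    next
      case (Suc j)
      then obtain z where z: "norm (z - p) \<le> real N" "norm (T z - z) \<le> (h ^^ (Suc k - j)) 1"
          "(norm (u - z))\<^sup>2 \<le> (norm (u - p))\<^sup>2 - real j * \<epsilon>" by auto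
      have "Suc k - j = Suc (k - j)" using Suc.prems by simp
      then obtain y where "norm (y - p) \<le> real N" "norm (T y - y) \<le> (h ^^ (k - j)) 1"
          "(norm (u - y))\<^sup>2 + \<epsilon> < (norm (u - z))\<^sup>2"
        using improve[of "k - j" z] z by auto
      then show ?case using z(3) by (intro exI[of _ y]) (auto simp: algebra_simps)
    qed
    from this[of "Suc k"] obtain y where
      "(norm (u - y))\<^sup>2 \<le> (norm (u - p))\<^sup>2 - real (Suc k) * \<epsilon>" by auto
    then have "real (Suc k) * \<epsilon> \<le> (norm (u - p))\<^sup>2"
      using zero_le_power2[of "norm (u - y)"] by linarith
    also have "\<dots> \<le> (real N / 2)\<^sup>2" using u by (intro power_mono) auto
    finally have "real (Suc k) * \<epsilon> \<le> (real N)\<^sup>2 / 4" by (simp add: power_divide)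
    then have "real (Suc k) \<le> (real N)\<^sup>2 / (4 * \<epsilon>)" using \<epsilon> by (simp add: field_simps)
    moreover have "(real N)\<^sup>2 / (4 * \<epsilon>) \<le> real k"
      unfolding k_def by (rule real_nat_ceiling_ge)
    ultimately show False by simp
  qed
  then obtain i z where "i \<le> k" "norm (z - p) \<le> real N" "norm (T z - z) \<le> h ((h ^^ i) 1)"
    "\<And>y. norm (y - p) \<le> real N \<Longrightarrow> norm (T y - y) \<le> (h ^^ i) 1 \<Longrightarrow>
      (norm (u - z))\<^sup>2 \<le> (norm (u - y))\<^sup>2 + \<epsilon>" by blast
  moreover have "0 < (h ^^ i) 1 \<and> (h ^^ i) 1 \<le> 1"
    using iterate_in_unit_interval h by blast
  moreover have "ms_phi N \<epsilon> h \<le> (h ^^ i) 1"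
    using \<open>i \<le> k\<close> unfolding k_def by (rule ms_phi_le)
  ultimately show thesis using that by blast
qed

text \<open>
  The variational inequality of the projection, with finite precision. It follows by comparing
  \<open>z\<close> with the point \<open>(1 - t) z + t y\<close> for \<open>t = \<epsilon> / (4 * N\<^sup>2)\<close>, which balances the optimality
  defect \<open>\<epsilon>\<^sup>2 / (4 * N\<^sup>2)\<close> of \<open>z\<close>, divided by \<open>t\<close>, against the second-order term in \<open>t\<close>. The square in
  \<open>\<eta> = \<xi>\<^sup>2 / (24 * N)\<close> is the loss in the near-convexity of the fixed point set.
\<close>

lemma approximate_variational_inequality:
  fixes T :: "'a::real_inner \<Rightarrow> 'a" and N :: nat
  assumes nonexp: "\<And>y z. norm (T y - T z) \<le> norm (y - z)"
    and fixed: "T p = p" and u: "2 * norm (u - p) \<le> real N" and N: "N \<noteq> 0"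
    and \<epsilon>: "\<epsilon> > 0"
    and h: "\<And>\<xi>. 0 < \<xi> \<Longrightarrow> \<xi> \<le> 1 \<Longrightarrow> 0 < h \<xi> \<and> h \<xi> \<le> 1"
  obtains \<eta> z where "0 < ms_Phi N \<epsilon> h" "ms_Phi N \<epsilon> h \<le> \<eta>"
    and "norm (z - p) \<le> real N" "norm (T z - z) \<le> h \<eta>"
    and "\<And>y. norm (y - p) \<le> real N \<Longrightarrow> norm (T y - y) \<le> \<eta> \<Longrightarrow> (u - z) \<bullet> (y - z) \<le> \<epsilon>"
proof -
  define R where "R = real N"
  have R: "R \<ge> 1" using N by (simp add: R_def)
  define \<epsilon>' where "\<epsilon>' = \<epsilon>\<^sup>2 / (4 * R\<^sup>2)"
  define h' where "h' = ms_h_tilde N h"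
  have scale: "0 < \<xi>\<^sup>2 / (24 * R) \<and> \<xi>\<^sup>2 / (24 * R) \<le> 1" if "0 < \<xi>" "\<xi> \<le> 1" for \<xi>
  proof -
    have "\<xi>\<^sup>2 \<le> 1" using that by (simp add: power_le_one)
    then show ?thesis using that R by (simp add: divide_le_eq)
  qed
  have h': "0 < h' \<xi> \<and> h' \<xi> \<le> 1" if "0 < \<xi>" "\<xi> \<le> 1" for \<xi>
    using scale[OF that] h[of "\<xi>\<^sup>2 / (24 * R)"]
    by (auto simp: h'_def ms_h_tilde_def R_def min_le_iff_disj)
  have \<epsilon>': "\<epsilon>' > 0" using \<epsilon> R by (simp add: \<epsilon>'_def)
  obtain \<xi> z where \<xi>: "ms_phi N \<epsilon>' h' \<le> \<xi>" "0 < \<xi>" "\<xi> \<le> 1"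
    and z: "norm (z - p) \<le> R" "norm (T z - z) \<le> h' \<xi>"
    and opt: "\<And>y. norm (y - p) \<le> R \<Longrightarrow> norm (T y - y) \<le> \<xi> \<Longrightarrow>
           (norm (u - z))\<^sup>2 \<le> (norm (u - y))\<^sup>2 + \<epsilon>'"
    using approximate_projection[where T = T and h = h', OF fixed u \<epsilon>' h'] unfolding R_def by blast
  define \<eta> where "\<eta> = \<xi>\<^sup>2 / (24 * R)"
  have \<eta>: "0 < \<eta>" "\<eta> \<le> 1" using scale \<xi> by (auto simp: \<eta>_def)
  have Tz: "norm (T z - z) \<le> h \<eta>" "norm (T z - z) \<le> \<eta>"
    using z(2) by (auto simp: h'_def ms_h_tilde_def \<eta>_def R_def)
  have phi_pos: "0 < ms_phi N \<epsilon>' h'" using h' by (rule ms_phi_pos)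
  have Phi: "ms_Phi N \<epsilon> h = (ms_phi N \<epsilon>' h')\<^sup>2 / (24 * R)"
    by (simp add: ms_Phi_def \<epsilon>'_def h'_def R_def)
  have "(ms_phi N \<epsilon>' h')\<^sup>2 \<le> \<xi>\<^sup>2" using \<xi> phi_pos by (intro power_mono) auto
  then have "ms_Phi N \<epsilon> h \<le> \<eta>" using R by (simp add: Phi \<eta>_def divide_right_mono)
  moreover have "0 < ms_Phi N \<epsilon> h" using R phi_pos by (simp add: Phi)
  moreover have "(u - z) \<bullet> (y - z) \<le> \<epsilon>"
    if y: "norm (y - p) \<le> R" "norm (T y - y) \<le> \<eta>" for y
  proof -
    have yz: "norm (y - z) \<le> 2 * R"
      using norm_diff_triangle_ineq[of y z p p] norm_triangle_ineq4[of "y - p" "z - p"] y z by simp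
    have uz: "norm (u - z) \<le> 2 * R"
      using norm_triangle_ineq4[of "u - p" "z - p"] u z R by (simp add: R_def)
    show ?thesis
    proof (cases "\<epsilon> \<le> 4 * R\<^sup>2")
      case False
      \<comment> \<open>then \<open>t\<close> would exceed 1, but for such large \<open>\<epsilon>\<close> the boundedness of the ball suffices\<close>
      have "(u - z) \<bullet> (y - z) \<le> norm (u - z) * norm (y - z)" by (rule norm_cauchy_schwarz)
      also have "\<dots> \<le> (2 * R) * (2 * R)" using uz yz R by (intro mult_mono) auto
      finally show ?thesis using False by (simp add: power2_eq_square)
    next
      case True
      define t where "t = \<epsilon> / (4 * R\<^sup>2)"
      have t: "0 < t" "t \<le> 1" using True \<epsilon> R by (auto simp: t_def divide_le_eq)
      define w where "w = (1 - t) *\<^sub>R z + t *\<^sub>R y"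
      have "w \<in> cball p R"
        unfolding w_def using convexD_alt[OF convex_cball, of z p R y t] y z t
        by (simp add: dist_norm norm_minus_commute)
      then have wp: "norm (w - p) \<le> R" by (simp add: dist_norm norm_minus_commute)
      have "(norm (T w - w))\<^sup>2 \<le> norm (z - y) * \<eta> + \<eta>\<^sup>2"
        unfolding w_def using t y Tz nonexp by (intro nonexpansive_segment_nearly_fixed) auto
      also have "\<dots> \<le> (2 * R) * \<eta> + R * \<eta>"
      proof (intro add_mono mult_right_mono)
        show "norm (z - y) \<le> 2 * R" using yz by (simp add: norm_minus_commute)
        show "\<eta>\<^sup>2 \<le> R * \<eta>" using \<eta> R by (simp add: power2_eq_square mult_right_mono)
      qed (use \<eta> in auto)
      also have "\<dots> = \<xi>\<^sup>2 / 8" using R by (simp add: \<eta>_def field_simps)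
      also have "\<dots> \<le> \<xi>\<^sup>2" by simp
      finally have "norm (T w - w) \<le> \<xi>" by (rule power2_le_imp_le) (use \<xi> in simp)
      then have "(norm (u - z))\<^sup>2 \<le> (norm (u - w))\<^sup>2 + \<epsilon>'" using opt wp by blast
      also have "(norm (u - w))\<^sup>2 = (norm (u - z))\<^sup>2 - 2 * t * ((u - z) \<bullet> (y - z)) + t\<^sup>2 * (norm (y - z))\<^sup>2"
      proof -
        have "u - w = (u - z) - t *\<^sub>R (y - z)" by (simp add: w_def algebra_simps)
        then show ?thesis
          by (simp only: power2_norm_eq_inner inner_diff_left[of "u - z"] inner_diff_right[of _ "u - z"]
              inner_scaleR_left inner_scaleR_right)
             (simp add: inner_commute power2_eq_square right_diff_distrib)
      qed
      finally have "2 * t * ((u - z) \<bullet> (y - z)) \<le> t\<^sup>2 * (norm (y - z))\<^sup>2 + \<epsilon>'" by simp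
      also have "\<dots> \<le> t\<^sup>2 * (2 * R)\<^sup>2 + \<epsilon>'"
        using yz by (intro add_right_mono mult_left_mono power_mono) auto
      also have "\<dots> = 2 * t * \<epsilon>"
        using R by (simp add: t_def \<epsilon>'_def power2_eq_square field_simps)
      finally show ?thesis using t by simp
    qed
  qed
  ultimately show thesis using that z(1) Tz(1) by (auto simp: R_def)
qed

section \<open>Recursive inequalities\<close>

text \<open>
  A recursive inequality of Xu type. The exponential is an upper bound for the product of the
  factors \<open>1 - a i\<close>; the term \<open>a n * b\<close> contributes \<open>b\<close> only once because each step
  forms a convex combination with it.
\<close>

lemma contractive_recursion_bound:
  fixes s a r :: "nat \<Rightarrow> real"
  assumes step: "\<And>n. K \<le> n \<Longrightarrow> n < m \<Longrightarrow> s (Suc n) \<le> (1 - a n) * s n + a n * b + r n"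
    and a: "\<And>n. 0 \<le> a n" "\<And>n. a n \<le> 1" and b: "0 \<le> b" and r: "\<And>n. 0 \<le> r n"
    and D: "s K \<le> D" "0 \<le> D" and "K \<le> m"
  shows "s m \<le> D * exp (- (\<Sum>i=K..<m. a i)) + b + (\<Sum>i=K..<m. r i)"
  using \<open>K \<le> m\<close> step
proof (induction m rule: dec_induct)
  case base
  then show ?case using D b by simp
next
  case (step n)
  let ?P = "D * exp (- (\<Sum>i=K..<n. a i))" and ?S = "\<Sum>i=K..<n. r i"
  have "s (Suc n) \<le> (1 - a n) * s n + a n * b + r n" using step by simp
  also have "\<dots> \<le> (1 - a n) * (?P + b + ?S) + a n * b + r n"
    using step a[of n] by (intro add_right_mono mult_left_mono) auto
  also have "\<dots> = (1 - a n) * ?P + b + (1 - a n) * ?S + r n" by (simp add: algebra_simps)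
  also have "\<dots> \<le> exp (- a n) * ?P + b + 1 * ?S + r n"
  proof (intro add_mono mult_right_mono order_refl)
    show "1 - a n \<le> exp (- a n)" using exp_ge_add_one_self[of "- a n"] by simp
  qed (use a[of n] D r in \<open>auto intro!: sum_nonneg\<close>)
  also have "\<dots> = D * exp (- (\<Sum>i=K..<Suc n. a i)) + b + (\<Sum>i=K..<Suc n. r i)"
  proof -
    have "- (\<Sum>i=K..<Suc n. a i) = - a n + - (\<Sum>i=K..<n. a i)" using step(1) by simp
    then show ?thesis using step(1) by (simp only: exp_add) simp
  qed
  finally show ?case .
qed

text \<open>
  The first \<open>K\<close> terms contribute at most \<open>K\<close>, so a rate of divergence for the whole series is also
  one for its tails.
\<close>

lemma sum_from_ge:
  fixes a :: "nat \<Rightarrow> real"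
  assumes a: "\<And>n. 0 \<le> a n" "\<And>n. a n \<le> 1"
    and total: "real (K + L) \<le> (\<Sum>i=0..G. a i)" and m: "G + 1 \<le> m"
  shows "K \<le> m" and "real L \<le> (\<Sum>i=K..<m. a i)"
proof -
  have le: "real (K + L) \<le> (\<Sum>i=0..<m. a i)"
    using total m a(1) sum_mono2[of "{0..<m}" "{0..G}" a] by fastforce
  also have "\<dots> \<le> real m" using sum_bounded_above[of "{0..<m}" a 1] a(2) by simp
  finally show "K \<le> m" by linarith
  have "(\<Sum>i=0..<K. a i) \<le> real K" using sum_bounded_above[of "{0..<K}" a 1] a(2) by simp
  moreover have "(\<Sum>i=0..<K. a i) + (\<Sum>i=K..<m. a i) = (\<Sum>i=0..<m. a i)"
    using \<open>K \<le> m\<close> by (intro sum.atLeastLessThan_concat) auto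
  ultimately show "real L \<le> (\<Sum>i=K..<m. a i)" using le by simp
qed

lemma tail_sum_le:
  fixes a :: "nat \<Rightarrow> real"
  assumes "\<And>n. (\<Sum>i=G+1..G+n. \<bar>a i\<bar>) \<le> \<epsilon>" and "G \<le> V"
  shows "(\<Sum>i=V+1..<m. \<bar>a i\<bar>) \<le> \<epsilon>"
proof -
  have "(\<Sum>i=V+1..<m. \<bar>a i\<bar>) \<le> (\<Sum>i=G+1..G+m. \<bar>a i\<bar>)"
    using \<open>G \<le> V\<close> by (intro sum_mono2) auto
  then show ?thesis using assms(1)[of m] by linarith
qed

lemma mult_exp_neg_le:
  fixes D e S :: real
  assumes "0 < D" "0 < e" "real (nat \<lceil>ln (D / e)\<rceil>) \<le> S"
  shows "D * exp (- S) \<le> e"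
proof -
  have "ln (D / e) \<le> S" using assms(3) real_nat_ceiling_ge order_trans by blast
  then have "exp (ln (D / e)) \<le> exp S" by simp
  then have "D / e \<le> exp S" using assms(1,2) by simp
  then show ?thesis using assms by (simp add: exp_minus field_simps)
qed

section \<open>The alternating Halpern--Mann iteration\<close>

locale halpern_mann =
  fixes T :: "'a::{real_inner,complete_space} \<Rightarrow> 'a" and u p :: 'a and x :: "nat \<Rightarrow> 'a"
    and \<alpha> \<beta> :: "nat \<Rightarrow> real" and N :: nat and g :: real
    and \<Gamma>1 \<Gamma>3 \<Gamma>4 :: "real \<Rightarrow> nat" and \<Gamma>2 :: "nat \<Rightarrow> nat"
  assumes nonexp: "norm (T y - T z) \<le> norm (y - z)"
    and fixed: "T p = p"
    and alpha: "0 \<le> \<alpha> n" "\<alpha> n \<le> 1"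
    and g_pos: "0 < g"
    and beta: "g \<le> \<beta> n" "\<beta> n \<le> 1 - g"
    and x_odd: "x (2 * n + 1) = (1 - \<alpha> n) *\<^sub>R x (2 * n) + \<alpha> n *\<^sub>R u"
    and x_even: "x (2 * n + 2) = (1 - \<beta> n) *\<^sub>R T (x (2 * n + 1)) + \<beta> n *\<^sub>R x (2 * n + 1)"
    and N_pos: "N \<noteq> 0"
    and x0_bound: "norm (x 0 - p) \<le> real N"
    and u_bound: "2 * norm (u - p) \<le> real N"
    and mono_Gamma1: "antimono_on {0<..} \<Gamma>1"
    and mono_Gamma2: "mono \<Gamma>2"
    and mono_Gamma3: "antimono_on {0<..} \<Gamma>3"
    and mono_Gamma4: "antimono_on {0<..} \<Gamma>4"
    and alpha_null: "\<epsilon> > 0 \<Longrightarrow> n \<ge> \<Gamma>1 \<epsilon> \<Longrightarrow> \<alpha> n \<le> \<epsilon>"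
    and alpha_diverges: "(\<Sum>i = 0..\<Gamma>2 k. \<alpha> i) \<ge> real k"
    and alpha_variation: "\<epsilon> > 0 \<Longrightarrow> (\<Sum>i = \<Gamma>3 \<epsilon> + 1..\<Gamma>3 \<epsilon> + n. \<bar>\<alpha> (i + 1) - \<alpha> i\<bar>) \<le> \<epsilon>"
    and beta_variation: "\<epsilon> > 0 \<Longrightarrow> (\<Sum>i = \<Gamma>4 \<epsilon> + 1..\<Gamma>4 \<epsilon> + n. \<bar>\<beta> (i + 1) - \<beta> i\<bar>) \<le> \<epsilon>"
begin

abbreviation "V \<equiv> ms_V N \<Gamma>3 \<Gamma>4"
abbreviation "theta1 \<equiv> ms_theta1 N \<Gamma>2 \<Gamma>3 \<Gamma>4"
abbreviation "theta3 \<equiv> ms_theta3 N g \<Gamma>1 \<Gamma>2 \<Gamma>3 \<Gamma>4"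
abbreviation "theta4 \<equiv> ms_theta4 N g \<Gamma>1 \<Gamma>2 \<Gamma>3 \<Gamma>4"
abbreviation "rho2 \<equiv> ms_rho2 N g \<Gamma>1 \<Gamma>2 \<Gamma>3 \<Gamma>4"
abbreviation "rho \<equiv> ms_rho N g \<Gamma>1 \<Gamma>2 \<Gamma>3 \<Gamma>4"

lemma N_ge_1: "1 \<le> real N" using N_pos by simp

lemma beta_01: "0 \<le> \<beta> n" "\<beta> n \<le> 1"
  using beta[of n] g_pos by linarith+

lemma T_dist_fixed: "T y = y \<Longrightarrow> norm (T z - y) \<le> norm (z - y)"
  using nonexp[of z y] by simp

lemma norm_even_step_le:
  assumes "T y = y"
  shows "norm (x (2 * n + 2) - y) \<le> norm (x (2 * n + 1) - y)"
proof -
  let ?r = "norm (x (2 * n + 1) - y)"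
  have "(1 - \<beta> n) *\<^sub>R T (x (2 * n + 1)) + \<beta> n *\<^sub>R x (2 * n + 1) \<in> cball y ?r"
    using T_dist_fixed[OF assms, of "x (2 * n + 1)"] beta_01
    by (intro convexD_alt[OF convex_cball]) (auto simp: dist_norm norm_minus_commute[of y])
  then show ?thesis using x_even[of n] by (simp add: dist_norm norm_minus_commute)
qed

lemma iterates_bounded_pair: "norm (x (2 * n) - p) \<le> real N \<and> norm (x (2 * n + 1) - p) \<le> real N"
proof -
  have odd: "norm (x (2 * n + 1) - p) \<le> real N" if "norm (x (2 * n) - p) \<le> real N" for n
  proof -
    have "norm (u - p) \<le> real N" using u_bound norm_ge_zero[of "u - p"] by linarith
    then have "(1 - \<alpha> n) *\<^sub>R x (2 * n) + \<alpha> n *\<^sub>R u \<in> cball p (real N)"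
      using that alpha
      by (intro convexD_alt[OF convex_cball]) (auto simp: dist_norm norm_minus_commute)
    then show ?thesis using x_odd[of n] by (simp add: dist_norm norm_minus_commute)
  qed
  have "norm (x (2 * n) - p) \<le> real N"
  proof (induction n)
    case (Suc n)
    then show ?case using odd[of n] norm_even_step_le[OF fixed, of n] by simp
  qed (use x0_bound in simp)
  with odd show ?thesis by blast
qed

lemma iterates_bounded: "norm (x n - p) \<le> real N"
proof (cases "even n")
  case True
  then show ?thesis using iterates_bounded_pair by (elim evenE) blast
next
  case False
  then show ?thesis using iterates_bounded_pair by (elim oddE) blast
qed

lemma iterate_dist_bound: "norm (y - p) \<le> real N \<Longrightarrow> norm (x n - y) \<le> 2 * real N"
  using norm_triangle_ineq4[of "x n - p" "y - p"] iterates_bounded[of n] by simp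

lemma T_iterate_dist_bound: "norm (T (x n) - x n) \<le> 2 * real N"
  using norm_triangle_ineq4[of "T (x n) - p" "x n - p"] iterates_bounded[of n]
    T_dist_fixed[OF fixed, of "x n"] by simp

lemma anchor_dist_bound: "norm (x n - u) \<le> 2 * real N"
  using iterate_dist_bound[of u n] u_bound norm_ge_zero[of "u - p"] by linarith

text \<open>
  For constant parameters one cycle is a contraction with factor \<open>1 - \<alpha>\<close>; a change of a parameter
  is multiplied by the distance of the two points that it mixes, which is at most \<open>2 * N\<close>.
\<close>

lemma even_difference_step:
  "norm (x (2 * Suc n + 2) - x (2 * Suc n)) \<le> (1 - \<alpha> (Suc n)) * norm (x (2 * n + 2) - x (2 * n))
    + 2 * real N * (\<bar>\<alpha> (Suc n) - \<alpha> n\<bar> + \<bar>\<beta> (Suc n) - \<beta> n\<bar>)"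
proof -
  let ?a = "x (2 * Suc n + 1)" and ?b = "x (2 * n + 1)"
  have even_n: "x (2 * Suc n) = x (2 * n + 2)" by simp
  have "?a - ?b = (1 - \<alpha> (Suc n)) *\<^sub>R (x (2 * n + 2) - x (2 * n))
      + (\<alpha> n - \<alpha> (Suc n)) *\<^sub>R (x (2 * n) - u)"
    by (simp only: x_odd even_n) (simp add: algebra_simps)
  then have "norm (?a - ?b) \<le> (1 - \<alpha> (Suc n)) * norm (x (2 * n + 2) - x (2 * n))
      + \<bar>\<alpha> (Suc n) - \<alpha> n\<bar> * norm (x (2 * n) - u)"
    using norm_triangle_ineq[of "(1 - \<alpha> (Suc n)) *\<^sub>R (x (2 * n + 2) - x (2 * n))"
        "(\<alpha> n - \<alpha> (Suc n)) *\<^sub>R (x (2 * n) - u)"] alpha[of "Suc n"]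
    by (simp add: abs_minus_commute)
  also have "\<dots> \<le> (1 - \<alpha> (Suc n)) * norm (x (2 * n + 2) - x (2 * n))
      + \<bar>\<alpha> (Suc n) - \<alpha> n\<bar> * (2 * real N)"
    using anchor_dist_bound by (intro add_left_mono mult_left_mono) auto
  finally have odd: "norm (?a - ?b) \<le> \<dots>" .
  have "x (2 * Suc n + 2) - x (2 * n + 2)
      = ((1 - \<beta> (Suc n)) *\<^sub>R (T ?a - T ?b) + \<beta> (Suc n) *\<^sub>R (?a - ?b))
        + (\<beta> n - \<beta> (Suc n)) *\<^sub>R (T ?b - ?b)"
    by (simp only: x_even) (simp add: algebra_simps)
  also have "norm \<dots> \<le> norm ((1 - \<beta> (Suc n)) *\<^sub>R (T ?a - T ?b) + \<beta> (Suc n) *\<^sub>R (?a - ?b))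
        + norm ((\<beta> n - \<beta> (Suc n)) *\<^sub>R (T ?b - ?b))" by (rule norm_triangle_ineq)
  also have "\<dots> \<le> (norm ((1 - \<beta> (Suc n)) *\<^sub>R (T ?a - T ?b)) + norm (\<beta> (Suc n) *\<^sub>R (?a - ?b)))
        + norm ((\<beta> n - \<beta> (Suc n)) *\<^sub>R (T ?b - ?b))"
    by (intro add_right_mono norm_triangle_ineq)
  also have "\<dots> = (1 - \<beta> (Suc n)) * norm (T ?a - T ?b) + \<beta> (Suc n) * norm (?a - ?b)
        + \<bar>\<beta> (Suc n) - \<beta> n\<bar> * norm (T ?b - ?b)"
    using beta_01[of "Suc n"] by (simp add: abs_minus_commute)
  also have "\<dots> \<le> (1 - \<beta> (Suc n)) * norm (?a - ?b) + \<beta> (Suc n) * norm (?a - ?b)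
        + \<bar>\<beta> (Suc n) - \<beta> n\<bar> * (2 * real N)"
    using beta_01[of "Suc n"] nonexp T_iterate_dist_bound
    by (intro add_mono mult_left_mono) auto
  finally show ?thesis using odd by (simp add: algebra_simps)
qed

lemma even_differences_small:
  assumes \<epsilon>: "\<epsilon> > 0" and n: "theta1 \<epsilon> \<le> n"
  shows "norm (x (2 * n + 2) - x (2 * n)) \<le> \<epsilon>"
proof -
  \<comment> \<open>beyond index \<open>W\<close>, the variation adds at most \<open>\<epsilon> / 2\<close>; the other half is the decay of the initial
    value at \<open>W + 1\<close>, for which a sum of the \<open>\<alpha> i\<close> of size \<open>L\<close> is enough\<close>
  define L where "L = nat \<lceil>ln (4 * real N / \<epsilon>)\<rceil>"
  define W where "W = V (\<epsilon> / 2)"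
  define s where "s n = norm (x (2 * n + 2) - x (2 * n))" for n
  define r where "r n = 2 * real N * (\<bar>\<alpha> (n + 1) - \<alpha> n\<bar> + \<bar>\<beta> (n + 1) - \<beta> n\<bar>)" for n
  have le: "\<Gamma>2 ((W + 2) + L) + 1 \<le> Suc n"
    using n by (simp add: ms_theta1_def L_def W_def algebra_simps)
  note drop_W = sum_from_ge[OF alpha alpha_diverges le]
  have W: "W + 1 \<le> n" using drop_W(1) by simp
  have L: "real L \<le> (\<Sum>i=W+1..<n. \<alpha> (Suc i))"
    using drop_W(2) sum.shift_bounds_Suc_ivl[of \<alpha> "W + 1" n] by simp
  have N: "0 < real N" using N_pos by simp
  have "s n \<le> 2 * real N * exp (- (\<Sum>i=W+1..<n. \<alpha> (Suc i))) + 0 + (\<Sum>i=W+1..<n. r i)"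
  proof (rule contractive_recursion_bound)
    show "s (W + 1) \<le> 2 * real N"
      using iterate_dist_bound[OF iterates_bounded] by (simp add: s_def)
    show "s (Suc i) \<le> (1 - \<alpha> (Suc i)) * s i + \<alpha> (Suc i) * 0 + r i" for i
      using even_difference_step[of i] by (simp add: s_def r_def)
    show "0 \<le> r i" for i by (simp add: r_def)
  qed (use alpha W in auto)
  moreover have "2 * real N * exp (- (\<Sum>i=W+1..<n. \<alpha> (Suc i))) \<le> \<epsilon> / 2"
    using N \<epsilon> L by (intro mult_exp_neg_le) (auto simp: L_def)
  moreover have "(\<Sum>i=W+1..<n. r i) \<le> \<epsilon> / 2"
  proof -
    define e where "e = \<epsilon> / 2 / (4 * real N)"
    have e: "e > 0" using \<epsilon> N by (simp add: e_def)
    have "(\<Sum>i=W+1..<n. \<bar>\<alpha> (i + 1) - \<alpha> i\<bar>) \<le> e"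
      by (rule tail_sum_le[OF alpha_variation[OF e]]) (simp add: W_def ms_V_def e_def)
    moreover have "(\<Sum>i=W+1..<n. \<bar>\<beta> (i + 1) - \<beta> i\<bar>) \<le> e"
      by (rule tail_sum_le[OF beta_variation[OF e]]) (simp add: W_def ms_V_def e_def)
    ultimately have "2 * real N * ((\<Sum>i=W+1..<n. \<bar>\<alpha> (i + 1) - \<alpha> i\<bar>)
        + (\<Sum>i=W+1..<n. \<bar>\<beta> (i + 1) - \<beta> i\<bar>)) \<le> 2 * real N * (e + e)"
      by (intro mult_left_mono add_mono) auto
    moreover have "(\<Sum>i=W+1..<n. r i) = 2 * real N * ((\<Sum>i=W+1..<n. \<bar>\<alpha> (i + 1) - \<alpha> i\<bar>)
        + (\<Sum>i=W+1..<n. \<bar>\<beta> (i + 1) - \<beta> i\<bar>))"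
      unfolding r_def by (simp only: sum_distrib_left[symmetric] sum.distrib)
    moreover have "2 * real N * (e + e) = \<epsilon> / 2" using N by (simp add: e_def field_simps)
    ultimately show ?thesis by (simp only:)
  qed
  ultimately show ?thesis by (simp add: s_def)
qed

text \<open>
  Strict convexity of the squared norm: the Mann step decreases the distance to \<open>p\<close> by an amount
  quadratic in the displacement \<open>T x - x\<close>, whereas the distance cannot decrease
  substantially over a full cycle once the even iterates have become almost stationary.
\<close>

lemma odd_displacement_small:
  assumes \<epsilon>: "\<epsilon> > 0" and n: "theta3 \<epsilon> \<le> n"
  shows "norm (T (x (2 * n + 1)) - x (2 * n + 1)) \<le> \<epsilon>"
proof -
  let ?a = "norm (x (2 * n) - p)" and ?b = "norm (x (2 * n + 1) - p)"
    and ?c = "norm (x (2 * n + 2) - p)" and ?d = "norm (T (x (2 * n + 1)) - x (2 * n + 1))"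
  define e where "e = (g * \<epsilon>)\<^sup>2"
  have N: "0 < real N" using N_pos by simp
  have e: "e > 0" using \<epsilon> g_pos by (simp add: e_def)
  have "norm (x (2 * n + 2) - x (2 * n)) \<le> e / (8 * real N)"
    using n e N by (intro even_differences_small) (auto simp: ms_theta3_def e_def)
  then have step: "\<bar>?a - ?c\<bar> \<le> e / (8 * real N)"
    using norm_triangle_ineq3[of "x (2 * n) - p" "x (2 * n + 2) - p"]
    by (simp add: norm_minus_commute)
  have \<alpha>_small: "\<alpha> n \<le> e / (2 * (real N)\<^sup>2)"
    using n e N by (intro alpha_null) (auto simp: ms_theta3_def e_def)
  have "?c\<^sup>2 = (1 - \<beta> n) * (norm (T (x (2 * n + 1)) - p))\<^sup>2 + \<beta> n * ?b\<^sup>2 - \<beta> n * (1 - \<beta> n) * ?d\<^sup>2"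
    unfolding x_even by (rule norm_sq_convex_combination)
  also have "\<dots> \<le> (1 - \<beta> n) * ?b\<^sup>2 + \<beta> n * ?b\<^sup>2 - g * g * ?d\<^sup>2"
    using beta_01[of n] beta[of n] g_pos T_dist_fixed[OF fixed]
    by (intro add_mono diff_mono mult_left_mono mult_right_mono mult_mono power_mono) auto
  finally have c: "(g * ?d)\<^sup>2 \<le> ?b\<^sup>2 - ?c\<^sup>2" by (simp add: power2_eq_square algebra_simps)
  have "?b\<^sup>2 = (1 - \<alpha> n) * ?a\<^sup>2 + \<alpha> n * (norm (u - p))\<^sup>2 - \<alpha> n * (1 - \<alpha> n) * (norm (x (2 * n) - u))\<^sup>2"
    using norm_sq_convex_combination[of "\<alpha> n" "x (2 * n)" u p] by (simp only: x_odd)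
  also have "\<dots> \<le> 1 * ?a\<^sup>2 + e / (2 * (real N)\<^sup>2) * (real N)\<^sup>2 - 0"
  proof (intro add_mono diff_mono mult_right_mono mult_mono)
    have "norm (u - p) \<le> real N" using u_bound norm_ge_zero[of "u - p"] by linarith
    then show "(norm (u - p))\<^sup>2 \<le> (real N)\<^sup>2" by (intro power_mono) auto
  qed (use alpha[of n] \<alpha>_small e in auto)
  also have "\<dots> = ?a\<^sup>2 + e / 2" using N by simp
  finally have b: "?b\<^sup>2 \<le> ?a\<^sup>2 + e / 2" .
  have "?a\<^sup>2 - ?c\<^sup>2 = (?a + ?c) * (?a - ?c)" by (simp add: power2_eq_square algebra_simps)
  also have "\<dots> \<le> (?a + ?c) * \<bar>?a - ?c\<bar>" by (intro mult_left_mono) auto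
  also have "\<dots> \<le> (real N + real N) * (e / (8 * real N))"
    using iterates_bounded step by (intro mult_mono add_mono) auto
  also have "\<dots> = e / 4" using N by simp
  finally have "(g * ?d)\<^sup>2 \<le> e" using b c e by linarith
  then have "g * ?d \<le> g * \<epsilon>"
    unfolding e_def using g_pos \<epsilon> by (intro power2_le_imp_le[of "g * ?d"]) auto
  then show ?thesis using g_pos by simp
qed

lemma mann_step_le_displacement:
  "norm (x (2 * n + 2) - x (2 * n + 1)) \<le> norm (T (x (2 * n + 1)) - x (2 * n + 1))"
proof -
  have "x (2 * n + 2) - x (2 * n + 1) = (1 - \<beta> n) *\<^sub>R (T (x (2 * n + 1)) - x (2 * n + 1))"
    by (simp only: x_even) (simp add: algebra_simps)
  then show ?thesis
    using beta_01[of n] by (simp add: mult_left_le_one_le)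
qed

lemma halpern_step_small:
  assumes \<epsilon>: "\<epsilon> > 0" and n: "theta4 \<epsilon> \<le> n"
  shows "norm (x (2 * n + 1) - x (2 * n)) \<le> \<epsilon>"
proof -
  have "norm (x (2 * n + 2) - x (2 * n)) \<le> \<epsilon> / 2"
    using assms by (intro even_differences_small) (auto simp: ms_theta4_def)
  moreover have "norm (T (x (2 * n + 1)) - x (2 * n + 1)) \<le> \<epsilon> / 2"
    using assms by (intro odd_displacement_small) (auto simp: ms_theta4_def)
  moreover have "norm (x (2 * n + 1) - x (2 * n))
      \<le> norm (x (2 * n + 2) - x (2 * n)) + norm (x (2 * n + 2) - x (2 * n + 1))"
    using norm_triangle_ineq4[of "x (2 * n + 2) - x (2 * n)" "x (2 * n + 2) - x (2 * n + 1)"]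
    by simp
  ultimately show ?thesis using mann_step_le_displacement[of n] by linarith
qed

lemma displacement_small:
  assumes \<epsilon>: "\<epsilon> > 0" and m: "rho2 \<epsilon> \<le> m"
  shows "norm (T (x m) - x m) \<le> \<epsilon>"
proof -
  have odd: "norm (T (x (2 * n + 1)) - x (2 * n + 1)) \<le> \<epsilon> / 3" if "theta3 (\<epsilon> / 3) \<le> n" for n
    using \<epsilon> that by (intro odd_displacement_small) auto
  show ?thesis
  proof (cases "even m")
    case False
    then obtain n where n: "m = 2 * n + 1" by (elim oddE)
    then have "theta3 (\<epsilon> / 3) \<le> n" using m by (simp add: ms_rho2_def)
    then show ?thesis using odd[of n] \<epsilon> by (simp add: n)
  next
    case True
    then obtain k where k: "m = 2 * k" by (elim evenE)
    then have "theta3 (\<epsilon> / 3) + 1 \<le> k" using m by (simp add: ms_rho2_def)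
    then obtain n where n: "k = Suc n" "theta3 (\<epsilon> / 3) \<le> n" by (cases k) auto
    let ?y = "x (2 * n + 1)" and ?z = "x (2 * n + 2)"
    have "T ?z - ?z = (T ?z - T ?y) + (T ?y - ?y) - (?z - ?y)" by simp
    also have "norm \<dots> \<le> norm (T ?z - T ?y) + norm (T ?y - ?y) + norm (?z - ?y)"
      using norm_triangle_ineq4 norm_triangle_ineq
      by (meson add_right_mono order_trans)
    finally have "norm (T ?z - ?z) \<le> norm (T ?z - T ?y) + norm (T ?y - ?y) + norm (?z - ?y)" .
    then show ?thesis
      using nonexp[of ?z ?y] mann_step_le_displacement[of n] odd[OF n(2)] by (simp add: k n)
  qed
qed

text \<open>
  One full cycle of the iteration, seen from a nearly fixed point \<open>z\<close>: the Halpern step contracts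
  the squared distance up to the variational term, the Mann step loses at most the
  displacement of \<open>z\<close>.
\<close>

lemma cycle_inequality:
  assumes z: "norm (z - p) \<le> real N" and \<delta>: "norm (T z - z) \<le> \<delta>" "\<delta> \<le> 1"
    and v: "(u - z) \<bullet> (x (2 * n + 1) - z) \<le> v"
  shows "(norm (x (2 * Suc n) - z))\<^sup>2
    \<le> (1 - \<alpha> n) * (norm (x (2 * n) - z))\<^sup>2 + \<alpha> n * (2 * v) + 5 * real N * \<delta>"
proof -
  let ?y = "x (2 * n + 1)"
  have \<delta>_nonneg: "0 \<le> \<delta>" using \<delta>(1) norm_ge_zero order_trans by blast
  have "(1 - \<alpha> n) *\<^sub>R (x (2 * n) - z) = (?y - z) - \<alpha> n *\<^sub>R (u - z)"
    by (simp only: x_odd) (simp add: algebra_simps)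
  then have "(1 - \<alpha> n)\<^sup>2 * (norm (x (2 * n) - z))\<^sup>2 = (norm ((?y - z) - \<alpha> n *\<^sub>R (u - z)))\<^sup>2"
    using alpha[of n] by (metis abs_of_nonneg diff_ge_0_iff_ge norm_scaleR power_mult_distrib)
  also have "\<dots> = (norm (?y - z))\<^sup>2 - 2 * \<alpha> n * ((u - z) \<bullet> (?y - z)) + (\<alpha> n * norm (u - z))\<^sup>2"
    by (simp only: power2_norm_eq_inner power_mult_distrib inner_diff_left[of "?y - z"]
        inner_diff_right[of _ "?y - z"] inner_scaleR_left inner_scaleR_right)
       (simp add: inner_commute power2_eq_square right_diff_distrib)
  finally have "(norm (?y - z))\<^sup>2 \<le> (1 - \<alpha> n)\<^sup>2 * (norm (x (2 * n) - z))\<^sup>2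
      + 2 * \<alpha> n * ((u - z) \<bullet> (?y - z))"
    using zero_le_power2[of "\<alpha> n * norm (u - z)"] by linarith
  also have "\<dots> \<le> (1 - \<alpha> n) * (norm (x (2 * n) - z))\<^sup>2 + 2 * \<alpha> n * v"
  proof (intro add_mono mult_right_mono mult_left_mono v)
    show "(1 - \<alpha> n)\<^sup>2 \<le> 1 - \<alpha> n"
      using alpha[of n] mult_left_le_one_le[of "1 - \<alpha> n" "1 - \<alpha> n"] by (simp add: power2_eq_square)
  qed (use alpha[of n] in auto)
  finally have halpern: "(norm (?y - z))\<^sup>2 \<le> \<dots>" .
  have "x (2 * Suc n) - z
      = ((1 - \<beta> n) *\<^sub>R (T ?y - T z) + \<beta> n *\<^sub>R (?y - z)) + (1 - \<beta> n) *\<^sub>R (T z - z)"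
    using x_even[of n] by (simp add: algebra_simps)
  also have "norm \<dots> \<le> (norm ((1 - \<beta> n) *\<^sub>R (T ?y - T z)) + norm (\<beta> n *\<^sub>R (?y - z)))
      + norm ((1 - \<beta> n) *\<^sub>R (T z - z))"
    by (intro norm_triangle_mono norm_triangle_ineq order_refl)
  also have "\<dots> = (1 - \<beta> n) * norm (T ?y - T z) + \<beta> n * norm (?y - z)
      + (1 - \<beta> n) * norm (T z - z)"
    using beta_01[of n] by simp
  also have "\<dots> \<le> (1 - \<beta> n) * norm (?y - z) + \<beta> n * norm (?y - z) + 1 * \<delta>"
    using beta_01[of n] nonexp \<delta>(1) by (intro add_mono mult_left_mono mult_mono) auto
  also have "\<dots> = norm (?y - z) + \<delta>" by (simp add: algebra_simps)
  finally have "(norm (x (2 * Suc n) - z))\<^sup>2 \<le> (norm (?y - z) + \<delta>)\<^sup>2"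
    by (intro power_mono) auto
  also have "\<dots> = (norm (?y - z))\<^sup>2 + (2 * norm (?y - z) * \<delta> + \<delta> * \<delta>)"
    by (simp add: power2_eq_square algebra_simps)
  also have "\<dots> \<le> (norm (?y - z))\<^sup>2 + (2 * (2 * real N) * \<delta> + real N * \<delta>)"
    using iterate_dist_bound[OF z] \<delta>(2) \<delta>_nonneg N_ge_1
    by (intro add_left_mono add_mono mult_right_mono mult_left_mono) auto
  finally show ?thesis using halpern by (simp add: algebra_simps)
qed

text \<open>
  Monotonicity of the rates is what allows the unknown level \<open>\<eta>\<close> of the approximate projection to be
  replaced by its lower bound \<open>ms_Phi\<close> in the final rate.
\<close>

lemma V_antimono:
  assumes "0 < a" "a \<le> b"
  shows "V b \<le> V a"
proof -
  have "0 < a / (4 * real N)" "a / (4 * real N) \<le> b / (4 * real N)"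
    using assms N_pos by (auto simp: divide_right_mono)
  then have "\<Gamma>3 (b / (4 * real N)) \<le> \<Gamma>3 (a / (4 * real N))"
    "\<Gamma>4 (b / (4 * real N)) \<le> \<Gamma>4 (a / (4 * real N))"
    using monotone_onD[OF mono_Gamma3] monotone_onD[OF mono_Gamma4] by auto
  then show ?thesis by (auto simp: ms_V_def)
qed

lemma theta1_antimono:
  assumes "0 < a" "a \<le> b"
  shows "theta1 b \<le> theta1 a"
proof -
  have "4 * real N / b \<le> 4 * real N / a" using assms N_pos by (intro divide_left_mono) auto
  then have "ln (4 * real N / b) \<le> ln (4 * real N / a)" using assms N_pos by simp
  then have "nat \<lceil>ln (4 * real N / b)\<rceil> \<le> nat \<lceil>ln (4 * real N / a)\<rceil>"
    by (intro nat_mono ceiling_mono)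
  then show ?thesis
    unfolding ms_theta1_def using assms
    by (intro add_right_mono monoD[OF mono_Gamma2] add_mono V_antimono) auto
qed

lemma theta3_antimono:
  assumes "0 < a" "a \<le> b"
  shows "theta3 b \<le> theta3 a"
proof -
  have sq: "0 < (g * a)\<^sup>2" "(g * a)\<^sup>2 \<le> (g * b)\<^sup>2"
    using assms g_pos by (auto intro!: power_mono)
  have "theta1 ((g * b)\<^sup>2 / (8 * real N)) \<le> theta1 ((g * a)\<^sup>2 / (8 * real N))"
    using sq N_pos by (intro theta1_antimono divide_right_mono) auto
  moreover have "0 < (g * a)\<^sup>2 / (2 * (real N)\<^sup>2)"
    and "(g * a)\<^sup>2 / (2 * (real N)\<^sup>2) \<le> (g * b)\<^sup>2 / (2 * (real N)\<^sup>2)"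
    using sq N_pos by (simp_all add: divide_right_mono)
  then have "\<Gamma>1 ((g * b)\<^sup>2 / (2 * (real N)\<^sup>2)) \<le> \<Gamma>1 ((g * a)\<^sup>2 / (2 * (real N)\<^sup>2))"
    using monotone_onD[OF mono_Gamma1] by auto
  ultimately show ?thesis by (auto simp: ms_theta3_def)
qed

lemma theta4_antimono:
  assumes "0 < a" "a \<le> b"
  shows "theta4 b \<le> theta4 a"
  using theta1_antimono[of "a / 2" "b / 2"] theta3_antimono[of "a / 2" "b / 2"] assms
  by (auto simp: ms_theta4_def)

lemma rho_antimono:
  assumes "0 < a" "a \<le> b"
  shows "rho b \<le> rho a"
proof -
  have "0 < a / (4 * real N)" "a / (4 * real N) \<le> b / (4 * real N)"
    using assms N_pos by (auto simp: divide_right_mono)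
  then have "\<Gamma>1 (b / (4 * real N)) \<le> \<Gamma>1 (a / (4 * real N))"
    using monotone_onD[OF mono_Gamma1] by auto
  then show ?thesis
    using theta3_antimono[of "a / 3" "b / 3"] theta4_antimono[of "a / 6" "b / 6"] assms
    by (auto simp: ms_rho_def ms_rho2_def ms_rho3_def)
qed

text \<open>
  On a long interval the iterates stay close to one approximate projection \<open>z\<close>. The required
  precision of \<open>z\<close> as a fixed point is allowed to depend on the index \<open>n = rho \<eta>\<close> from which its
  variational inequality applies: it is chosen so small that the errors accumulated over all
  cycles up to the end \<open>f n0\<close> of the interval stay below \<open>\<epsilon>\<^sup>2 / 96\<close>.
\<close>

lemma iterates_near_approximate_projection:
  assumes \<epsilon>: "\<epsilon> > 0"
  obtains n0 z where "n0 \<le> ms_mu N g \<Gamma>1 \<Gamma>2 \<Gamma>3 \<Gamma>4 \<epsilon> f"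
    and "\<And>i. n0 \<le> i \<Longrightarrow> i \<le> f n0 \<Longrightarrow> norm (x i - z) \<le> \<epsilon> / 2"
proof -
  define e where "e = ms_eps_tilde \<epsilon>"
  define \<Delta> where "\<Delta> = ms_Delta N g \<Gamma>1 \<Gamma>2 \<Gamma>3 \<Gamma>4 \<epsilon> f"
  define S where "S = ms_Sigma N g \<Gamma>1 \<Gamma>2 \<Gamma>3 \<Gamma>4 \<epsilon>"
  define h where "h \<eta> = \<Delta> (rho \<eta>)" for \<eta>
  have N: "0 < real N" using N_pos by simp
  have e: "e > 0" "e = (\<epsilon> / 4)\<^sup>2" using \<epsilon> by (auto simp: e_def ms_eps_tilde_def power_divide)
  have h: "0 < h \<xi> \<and> h \<xi> \<le> 1" for \<xi>
  proof -
    have "0 < 30 * real N * (real (ms_P N g \<Gamma>1 \<Gamma>2 \<Gamma>3 \<Gamma>4 \<epsilon> f (rho \<xi>)) + 1)" using N by simp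
    then show ?thesis using e(1) by (auto simp: h_def \<Delta>_def ms_Delta_def e_def)
  qed
  have e24: "e / 24 > 0" using e by simp
  obtain \<eta> z where \<eta>: "0 < ms_Phi N (e / 24) h" "ms_Phi N (e / 24) h \<le> \<eta>"
    and z: "norm (z - p) \<le> real N" "norm (T z - z) \<le> h \<eta>"
    and var: "\<And>y. norm (y - p) \<le> real N \<Longrightarrow> norm (T y - y) \<le> \<eta> \<Longrightarrow> (u - z) \<bullet> (y - z) \<le> e / 24"
    using approximate_variational_inequality[where T = T and h = h,
        OF nonexp fixed u_bound N_pos e24 h] by blast
  define n where "n = rho \<eta>"
  define n0 where "n0 = 2 * max (S n) (theta4 (\<epsilon> / 4)) + 1"
  have "n \<le> ms_Psi N g \<Gamma>1 \<Gamma>2 \<Gamma>3 \<Gamma>4 (e / 24) \<Delta>"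
    unfolding n_def ms_Psi_def using rho_antimono[OF \<eta>] by (simp add: h_def[abs_def])
  then have "S n \<le> S (ms_Psi N g \<Gamma>1 \<Gamma>2 \<Gamma>3 \<Gamma>4 (e / 24) \<Delta>)"
    unfolding S_def ms_Sigma_def ms_K_def
    by (intro add_right_mono monoD[OF mono_Gamma2]) auto
  then have n0_le: "n0 \<le> ms_mu N g \<Gamma>1 \<Gamma>2 \<Gamma>3 \<Gamma>4 \<epsilon> f"
    by (auto simp: n0_def ms_mu_def S_def e_def \<Delta>_def)
  define \<delta> where "\<delta> = \<Delta> n"
  have Tz: "norm (T z - z) \<le> \<delta>" using z(2) by (simp add: h_def n_def \<delta>_def)
  have "h \<eta> = \<delta>" by (simp add: h_def n_def \<delta>_def)
  then have \<delta>: "0 < \<delta>" "\<delta> \<le> 1" using h[of \<eta>] by auto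
  have \<delta>_small: "5 * real N * \<delta> * (real (f n0) + 1) \<le> e / 6"
  proof -
    have "\<delta> \<le> e / (30 * real N * (real (f n0) + 1))"
      by (simp add: \<delta>_def \<Delta>_def ms_Delta_def ms_P_def n0_def S_def e_def)
    then have "\<delta> * (30 * real N * (real (f n0) + 1)) \<le> e"
      using N by (simp add: pos_le_divide_eq)
    then show ?thesis by (simp add: algebra_simps)
  qed
  have even_close: "norm (x (2 * k) - z) \<le> \<epsilon> / 4" if k: "S n \<le> k" "k \<le> f n0" for k
  proof -
    define K where "K = ms_K N g \<Gamma>1 \<Gamma>2 \<Gamma>3 \<Gamma>4 \<epsilon> n"
    define L where "L = nat \<lceil>ln (12 * (real N)\<^sup>2 / e)\<rceil>"
    have le: "\<Gamma>2 (K + L) + 1 \<le> k" using k(1) by (simp add: S_def ms_Sigma_def K_def L_def e_def)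
    note drop_K = sum_from_ge[OF alpha alpha_diverges le]
    have "n \<le> K" by (simp add: K_def ms_K_def)
    define s where "s j = (norm (x (2 * j) - z))\<^sup>2" for j
    have "s k \<le> (2 * real N)\<^sup>2 * exp (- (\<Sum>i=K..<k. \<alpha> i)) + 2 * (e / 24)
        + (\<Sum>i=K..<k. 5 * real N * \<delta>)"
    proof (rule contractive_recursion_bound)
      show "s (Suc j) \<le> (1 - \<alpha> j) * s j + \<alpha> j * (2 * (e / 24)) + 5 * real N * \<delta>"
        if "K \<le> j" for j
        unfolding s_def
      proof (rule cycle_inequality[OF z(1) Tz \<delta>(2)])
        have "rho2 \<eta> \<le> 2 * j + 1" using that \<open>n \<le> K\<close> by (simp add: n_def ms_rho_def)
        then show "(u - z) \<bullet> (x (2 * j + 1) - z) \<le> e / 24"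
          using \<eta> by (intro var iterates_bounded displacement_small) auto
      qed
      show "s K \<le> (2 * real N)\<^sup>2"
        unfolding s_def using iterate_dist_bound[OF z(1)] by (intro power_mono) auto
    qed (use alpha e \<delta> drop_K in auto)
    moreover have "(2 * real N)\<^sup>2 * exp (- (\<Sum>i=K..<k. \<alpha> i)) \<le> e / 3"
    proof (rule mult_exp_neg_le)
      have "(2 * real N)\<^sup>2 / (e / 3) = 12 * (real N)\<^sup>2 / e" by (simp add: power_mult_distrib)
      then show "real (nat \<lceil>ln ((2 * real N)\<^sup>2 / (e / 3))\<rceil>) \<le> (\<Sum>i=K..<k. \<alpha> i)"
        using drop_K(2) by (simp add: L_def)
    qed (use N e in auto)
    moreover have "(\<Sum>i=K..<k. 5 * real N * \<delta>) \<le> e / 6"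
    proof -
      have "(\<Sum>i=K..<k. 5 * real N * \<delta>) = real (k - K) * (5 * real N * \<delta>)" by simp
      also have "\<dots> \<le> (real (f n0) + 1) * (5 * real N * \<delta>)"
        using k N \<delta> by (intro mult_right_mono) auto
      finally show ?thesis using \<delta>_small by (simp add: mult.commute)
    qed
    ultimately have "s k \<le> e" using e(1) by linarith
    then have "(norm (x (2 * k) - z))\<^sup>2 \<le> (\<epsilon> / 4)\<^sup>2" by (simp add: s_def e(2))
    then show ?thesis by (rule power2_le_imp_le) (use \<epsilon> in simp)
  qed
  have "norm (x i - z) \<le> \<epsilon> / 2" if i: "n0 \<le> i" "i \<le> f n0" for i
  proof (cases "even i")
    case True
    then obtain k where k: "i = 2 * k" by (elim evenE)
    then have "norm (x (2 * k) - z) \<le> \<epsilon> / 4" using i by (intro even_close) (auto simp: n0_def)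
    then show ?thesis using \<epsilon> by (simp add: k)
  next
    case False
    then obtain k where k: "i = 2 * k + 1" by (elim oddE)
    then have "norm (x (2 * k) - z) \<le> \<epsilon> / 4" using i by (intro even_close) (auto simp: n0_def)
    moreover have "norm (x (2 * k + 1) - x (2 * k)) \<le> \<epsilon> / 4"
      using i \<epsilon> by (intro halpern_step_small) (auto simp: n0_def k)
    ultimately show ?thesis
      using norm_triangle_ineq[of "x (2 * k + 1) - x (2 * k)" "x (2 * k) - z"] by (simp add: k)
  qed
  then show thesis using that n0_le by blast
qed

theorem metastability: "rate_of_metastability (ms_mu N g \<Gamma>1 \<Gamma>2 \<Gamma>3 \<Gamma>4) x"
  unfolding rate_of_metastability_def
proof (intro allI impI)
  fix \<epsilon> :: real and f :: "nat \<Rightarrow> nat" assume "\<epsilon> > 0"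
  then obtain n0 z where n0: "n0 \<le> ms_mu N g \<Gamma>1 \<Gamma>2 \<Gamma>3 \<Gamma>4 \<epsilon> f"
    and close: "\<And>i. n0 \<le> i \<Longrightarrow> i \<le> f n0 \<Longrightarrow> norm (x i - z) \<le> \<epsilon> / 2"
    using iterates_near_approximate_projection by blast
  have "norm (x i - x j) \<le> \<epsilon>" if "i \<in> {n0..f n0}" "j \<in> {n0..f n0}" for i j
    using norm_triangle_ineq4[of "x i - z" "x j - z"] close[of i] close[of j] that by simp
  then show "\<exists>n\<le>ms_mu N g \<Gamma>1 \<Gamma>2 \<Gamma>3 \<Gamma>4 \<epsilon> f. \<forall>i\<in>{n..f n}. \<forall>j\<in>{n..f n}. norm (x i - x j) \<le> \<epsilon>"
    using n0 by blast
qed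

text \<open>
  The limit satisfies the variational inequality: otherwise the squared distance to \<open>y\<close> would
  eventually drop by a fixed multiple of \<open>\<alpha> n\<close> in every cycle, and these drops are not summable.
\<close>

lemma limit_variational_inequality:
  assumes lim: "x \<longlonglongrightarrow> q" and y: "T y = y"
  shows "0 \<le> (u - q) \<bullet> (q - y)"
proof (rule ccontr)
  assume "\<not> ?thesis"
  then have neg: "(u - q) \<bullet> (q - y) < 0" by simp
  define c where "c = (u - q) \<bullet> (q - y)"
  define s where "s n = (norm (x (2 * n) - y))\<^sup>2" for n
  define d where "d n = 2 * ((1 - \<alpha> n) * ((x (2 * n) - y) \<bullet> (u - y))) - (2 - \<alpha> n) * s n
    + \<alpha> n * (norm (u - y))\<^sup>2" for n
  have step: "s (Suc n) \<le> s n + \<alpha> n * d n" for n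
  proof -
    have "s (Suc n) \<le> (norm (x (2 * n + 1) - y))\<^sup>2"
      unfolding s_def using norm_even_step_le[OF y, of n] by (intro power_mono) auto
    also have "x (2 * n + 1) - y = (1 - \<alpha> n) *\<^sub>R (x (2 * n) - y) + \<alpha> n *\<^sub>R (u - y)"
      by (simp only: x_odd) (simp add: algebra_simps)
    also have "(norm \<dots>)\<^sup>2 = s n + \<alpha> n * d n"
      unfolding s_def d_def power2_norm_eq_inner inner_add_left inner_add_right
        inner_scaleR_left inner_scaleR_right
      by (simp only: inner_commute[of "u - y" "x (2 * n) - y"]) algebra
    finally show ?thesis .
  qed
  have "strict_mono (\<lambda>n::nat. 2 * n)" by (rule strict_monoI) simp
  from LIMSEQ_subseq_LIMSEQ[OF lim this] have lim_even: "(\<lambda>n. x (2 * n)) \<longlonglongrightarrow> q"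
    by (simp add: o_def)
  have "\<alpha> \<longlonglongrightarrow> 0"
  proof (rule LIMSEQ_I)
    fix r :: real assume "0 < r"
    then have "norm (\<alpha> n - 0) < r" if "n \<ge> \<Gamma>1 (r / 2)" for n
      using alpha_null[of "r / 2" n] alpha[of n] that by simp
    then show "\<exists>M. \<forall>n\<ge>M. norm (\<alpha> n - 0) < r" by blast
  qed
  then have "d \<longlonglongrightarrow> 2 * ((1 - 0) * ((q - y) \<bullet> (u - y))) - (2 - 0) * (norm (q - y))\<^sup>2 + 0 * (norm (u - y))\<^sup>2"
    unfolding d_def[abs_def] s_def by (intro tendsto_intros lim_even)
  moreover have "2 * ((1 - 0) * ((q - y) \<bullet> (u - y))) - (2 - 0) * (norm (q - y))\<^sup>2 + 0 * (norm (u - y))\<^sup>2 = 2 * c"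
    by (simp add: c_def power2_norm_eq_inner inner_diff_left inner_diff_right inner_commute)
  ultimately have "d \<longlonglongrightarrow> 2 * c" by simp
  moreover have "2 * c < c" using neg by (simp add: c_def)
  ultimately have "\<forall>\<^sub>F n in sequentially. d n < c" by (rule order_tendstoD(2))
  then obtain M where M: "\<And>n. n \<ge> M \<Longrightarrow> d n < c"
    using eventually_sequentially by auto
  have drop: "s m \<le> s M + c * (\<Sum>i=M..<m. \<alpha> i)" if "M \<le> m" for m
    using that
  proof (induction m rule: dec_induct)
    case (step n)
    have "\<alpha> n * d n \<le> \<alpha> n * c"
      using M[of n] step(1) alpha[of n] by (intro mult_left_mono) auto
    then have "s (Suc n) \<le> s M + c * (\<Sum>i=M..<n. \<alpha> i) + \<alpha> n * c"
      using \<open>s (Suc n) \<le> s n + \<alpha> n * d n\<close> step(3) by linarith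
    also have "\<dots> = s M + c * (\<Sum>i=M..<Suc n. \<alpha> i)"
      using step(1) by (simp add: algebra_simps)
    finally show ?case .
  qed simp
  obtain L :: nat where L: "s M / (- c) < real L" using reals_Archimedean2 by blast
  define m where "m = \<Gamma>2 (M + L) + 1"
  have m: "M \<le> m" "real L \<le> (\<Sum>i=M..<m. \<alpha> i)"
    using sum_from_ge[OF alpha alpha_diverges, of M L m] by (simp_all add: m_def)
  have "0 \<le> s m" by (simp add: s_def)
  also have "\<dots> \<le> s M + c * (\<Sum>i=M..<m. \<alpha> i)" by (rule drop[OF m(1)])
  also have "\<dots> \<le> s M + c * real L"
    using m(2) neg by (intro add_left_mono mult_left_mono_neg) (auto simp: c_def)
  also have "\<dots> < 0" using L neg by (simp add: c_def[symmetric] field_simps)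
  finally show False by simp
qed

lemma limit_is_fixed_point:
  assumes lim: "x \<longlonglongrightarrow> q"
  shows "T q = q"
proof -
  have "(\<lambda>n. norm (x n - q)) \<longlonglongrightarrow> 0" using lim by (simp add: LIM_zero tendsto_norm_zero)
  then have "(\<lambda>n. T (x n) - T q) \<longlonglongrightarrow> 0"
    by (rule Lim_null_comparison[rotated]) (simp add: nonexp)
  then have to_Tq: "(\<lambda>n. T (x n)) \<longlonglongrightarrow> T q" by (rule LIM_zero_cancel)
  have "(\<lambda>n. T (x n) - x n) \<longlonglongrightarrow> 0"
  proof (rule LIMSEQ_I)
    fix r :: real assume "0 < r"
    then have "norm (T (x n) - x n - 0) < r" if "n \<ge> rho2 (r / 2)" for n
      using displacement_small[of "r / 2" n] that by simp
    then show "\<exists>M. \<forall>n\<ge>M. norm (T (x n) - x n - 0) < r" by blast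
  qed
  then have "(\<lambda>n. (T (x n) - x n) + x n) \<longlonglongrightarrow> 0 + q" using lim by (rule tendsto_add)
  then have "(\<lambda>n. T (x n)) \<longlonglongrightarrow> q" by simp
  with to_Tq show ?thesis by (rule LIMSEQ_unique)
qed

end

lemma rate_of_metastability_imp_Cauchy:
  assumes "rate_of_metastability M x"
  shows "Cauchy x"
proof (rule ccontr)
  assume "\<not> Cauchy x"
  then obtain e where e: "e > 0" and far: "\<And>n. \<exists>i\<ge>n. \<exists>j\<ge>n. e \<le> dist (x i) (x j)"
    unfolding Cauchy_def by (meson not_le)
  then obtain a b where ab: "\<And>n. a n \<ge> n" "\<And>n. b n \<ge> n" "\<And>n. e \<le> dist (x (a n)) (x (b n))"
    by metis
  have "0 < e / 2" using e by simp
  then obtain n where "\<forall>i\<in>{n..max (a n) (b n)}. \<forall>j\<in>{n..max (a n) (b n)}. norm (x i - x j) \<le> e / 2"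
    using assms[unfolded rate_of_metastability_def, rule_format, of "e / 2" "\<lambda>n. max (a n) (b n)"]
    by blast
  then have "norm (x (a n) - x (b n)) \<le> e / 2" using ab by auto
  then show False using ab(3)[of n] e by (simp add: dist_norm)
qed

text \<open>
  The variational inequality gives \<open>(norm (u - q))\<^sup>2 + (norm (q - y))\<^sup>2 \<le> (norm (u - y))\<^sup>2\<close>, hence both
  optimality and uniqueness.
\<close>

lemma metric_proj_eqI:
  fixes q :: "'a::real_inner"
  assumes q: "q \<in> S" and var: "\<And>y. y \<in> S \<Longrightarrow> 0 \<le> (u - q) \<bullet> (q - y)"
  shows "metric_proj S u = q"
proof -
  have pyth: "(norm (u - q))\<^sup>2 + (norm (q - y))\<^sup>2 \<le> (norm (u - y))\<^sup>2" if "y \<in> S" for y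
    using var[OF that]
    by (simp add: power2_norm_eq_inner inner_diff_left inner_diff_right inner_commute)
  show ?thesis
    unfolding metric_proj_def
  proof (rule the_equality)
    have "norm (u - q) \<le> norm (u - y)" if "y \<in> S" for y
    proof (rule power2_le_imp_le)
      show "(norm (u - q))\<^sup>2 \<le> (norm (u - y))\<^sup>2"
        using pyth[OF that] zero_le_power2[of "norm (q - y)"] by linarith
    qed simp
    then show "q \<in> S \<and> (\<forall>y\<in>S. norm (u - q) \<le> norm (u - y))" using q by blast
  next
    fix r assume r: "r \<in> S \<and> (\<forall>y\<in>S. norm (u - r) \<le> norm (u - y))"
    then have "(norm (u - r))\<^sup>2 \<le> (norm (u - q))\<^sup>2" using q by (intro power_mono) auto
    then have "(norm (q - r))\<^sup>2 \<le> 0" using pyth[of r] r by linarith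
    then show "r = q" by simp
  qed
qed

theorem (in halpern_mann) convergence: "x \<longlonglongrightarrow> metric_proj {y. T y = y} u"
proof -
  have "Cauchy x" using metastability by (rule rate_of_metastability_imp_Cauchy)
  then obtain q where q: "x \<longlonglongrightarrow> q" using Cauchy_convergent_iff convergent_def by blast
  have "metric_proj {y. T y = y} u = q"
    using limit_is_fixed_point[OF q] limit_variational_inequality[OF q]
    by (intro metric_proj_eqI) auto
  with q show ?thesis by simp
qed

section \<open>The forward-backward iteration\<close>

text \<open>
  With \<open>\<kappa> = (4 * \<delta> - c) / (2 * \<delta>)\<close> the scheme is the alternating Halpern--Mann iteration of the
  nonexpansive relaxation \<open>(1 - \<kappa>) Id + \<kappa> F\<close> of the forward-backward operator \<open>F\<close>, with the Mann
  parameters \<open>\<beta>' n = 1 - (1 - \<beta> n) / \<kappa>\<close>. Since \<open>1 \<le> \<kappa> < 2\<close>, these vary no more than the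
  \<open>\<beta> n\<close>, and the bound \<open>\<gamma>\<close> on the \<open>\<beta> n\<close> turns into \<open>\<gamma> / 2\<close>.
\<close>

theorem corollary7p3:
  fixes U1 :: "'a::{real_inner, complete_space} \<Rightarrow> 'a set"
    and U2 :: "'a \<Rightarrow> 'a"
    and \<delta> c \<gamma> :: real
    and \<alpha> \<beta> :: "nat \<Rightarrow> real"
    and x0 u :: 'a
    and x :: "nat \<Rightarrow> 'a"
    and \<Gamma>1 \<Gamma>3 \<Gamma>4 :: "real \<Rightarrow> nat"
    and \<Gamma>2 :: "nat \<Rightarrow> nat"
    and N :: nat
  assumes U1: "maximal_monotone_op U1"
    and delta: "\<delta> > 0"
    and U2: "cocoercive \<delta> U2"
    and c: "c \<in> {0<..2 * \<delta>}"
    and alpha: "\<And>n. \<alpha> n \<in> {0..1}"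
    and beta: "\<And>n. \<beta> n \<in> {1 - (4 * \<delta> - c) / (2 * \<delta>)..1}"
    and x_0: "x 0 = x0"
    and x_odd: "\<And>n. x (2 * n + 1) = (1 - \<alpha> n) *\<^sub>R x (2 * n) + \<alpha> n *\<^sub>R u"
    and x_even: "\<And>n. x (2 * n + 2) =
        (1 - \<beta> n) *\<^sub>R resolvent c U1 (x (2 * n + 1) - c *\<^sub>R U2 (x (2 * n + 1)))
        + \<beta> n *\<^sub>R x (2 * n + 1)"
    and mono_Gamma1: "antimono_on {0<..} \<Gamma>1"
    and mono_Gamma2: "mono \<Gamma>2"
    and mono_Gamma3: "antimono_on {0<..} \<Gamma>3"
    and mono_Gamma4: "antimono_on {0<..} \<Gamma>4"
    and Q1: "\<And>\<epsilon> n. \<epsilon> > 0 \<Longrightarrow> n \<ge> \<Gamma>1 \<epsilon> \<Longrightarrow> \<alpha> n \<le> \<epsilon>"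
    and Q2: "\<And>k. (\<Sum>i = 0..\<Gamma>2 k. \<alpha> i) \<ge> real k"
    and Q3: "\<And>\<epsilon> n. \<epsilon> > 0 \<Longrightarrow> (\<Sum>i = \<Gamma>3 \<epsilon> + 1..\<Gamma>3 \<epsilon> + n. \<bar>\<alpha> (i + 1) - \<alpha> i\<bar>) \<le> \<epsilon>"
    and Q4: "\<And>\<epsilon> n. \<epsilon> > 0 \<Longrightarrow> (\<Sum>i = \<Gamma>4 \<epsilon> + 1..\<Gamma>4 \<epsilon> + n. \<bar>\<beta> (i + 1) - \<beta> i\<bar>) \<le> \<epsilon>"
    and N_pos: "N \<noteq> 0"
    and N_bound: "\<exists>p \<in> zer (op_sum U1 (single_op U2)).
        real N \<ge> max (norm (x0 - p)) (2 * norm (u - p))"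
    and gamma: "\<gamma> \<in> {0<..1}"
    and beta_gamma: "\<And>n. 1 - (4 * \<delta> - c) / (2 * \<delta>) + \<gamma> \<le> \<beta> n \<and> \<beta> n \<le> 1 - \<gamma>"
  shows "x \<longlonglongrightarrow> metric_proj (zer (op_sum U1 (single_op U2))) u \<and>
    rate_of_metastability (ms_mu N (\<gamma> / 2) \<Gamma>1 \<Gamma>2 \<Gamma>3 \<Gamma>4) x"
proof -
  define F where "F y = resolvent c U1 (y - c *\<^sub>R U2 y)" for y
  define \<kappa> where "\<kappa> = (4 * \<delta> - c) / (2 * \<delta>)"
  define T where "T y = (1 - \<kappa>) *\<^sub>R y + \<kappa> *\<^sub>R F y" for y
  define \<beta>' where "\<beta>' n = 1 - (1 - \<beta> n) / \<kappa>" for n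
  have c': "0 < c" "c \<le> 2 * \<delta>" using c by auto
  have \<kappa>: "1 \<le> \<kappa>" "\<kappa> < 2" using c' delta by (simp_all add: \<kappa>_def field_simps)
  have fixed_iff: "T y = y \<longleftrightarrow> y \<in> zer (op_sum U1 (single_op U2))" for y
  proof -
    have "T y - y = \<kappa> *\<^sub>R (F y - y)" by (simp add: T_def algebra_simps)
    then have "T y = y \<longleftrightarrow> F y = y" using \<kappa> by (metis eq_iff_diff_eq_0 scaleR_eq_0_iff not_one_le_zero)
    then show ?thesis
      unfolding F_def using fixed_point_forward_backward_iff_zero[OF U1 c'(1)] by blast
  qed
  obtain p where p: "p \<in> zer (op_sum U1 (single_op U2))"
      "norm (x0 - p) \<le> real N" "2 * norm (u - p) \<le> real N"
    using N_bound by auto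
  have \<beta>'_diff: "\<bar>\<beta>' (i + 1) - \<beta>' i\<bar> \<le> \<bar>\<beta> (i + 1) - \<beta> i\<bar>" for i
  proof -
    have "\<beta>' (i + 1) - \<beta>' i = (\<beta> (i + 1) - \<beta> i) / \<kappa>"
      by (simp add: \<beta>'_def diff_divide_distrib)
    then have "\<bar>\<beta>' (i + 1) - \<beta>' i\<bar> = \<bar>\<beta> (i + 1) - \<beta> i\<bar> / \<kappa>" using \<kappa> by (simp add: abs_divide)
    also have "\<dots> \<le> \<bar>\<beta> (i + 1) - \<beta> i\<bar> / 1" using \<kappa> by (intro divide_left_mono) auto
    finally show ?thesis by simp
  qed
  have \<beta>'_bounds: "\<gamma> / 2 \<le> \<beta>' n" "\<beta>' n \<le> 1 - \<gamma> / 2" for n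
  proof -
    have "\<gamma> / 2 \<le> \<gamma> / \<kappa>" using \<kappa> gamma by (intro divide_left_mono) auto
    moreover have "1 - \<beta> n \<le> \<kappa> - \<gamma>" "\<gamma> \<le> 1 - \<beta> n"
      using beta_gamma[of n] by (auto simp: \<kappa>_def)
    then have "(1 - \<beta> n) / \<kappa> \<le> (\<kappa> - \<gamma>) / \<kappa>" "\<gamma> / \<kappa> \<le> (1 - \<beta> n) / \<kappa>"
      using \<kappa> by (auto intro: divide_right_mono)
    moreover have "(\<kappa> - \<gamma>) / \<kappa> = 1 - \<gamma> / \<kappa>" using \<kappa> by (simp add: diff_divide_distrib)
    ultimately show "\<gamma> / 2 \<le> \<beta>' n" "\<beta>' n \<le> 1 - \<gamma> / 2"
      unfolding \<beta>'_def by linarith+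
  qed
  interpret halpern_mann T u p x \<alpha> \<beta>' N "\<gamma> / 2" \<Gamma>1 \<Gamma>3 \<Gamma>4 \<Gamma>2
  proof
    show "norm (T y - T z) \<le> norm (y - z)" for y z
      unfolding T_def
      by (rule forward_backward_relaxation_nonexpansive[OF U1 delta U2 c' F_def \<kappa>_def])
    show "T p = p" using fixed_iff p by blast
    show "0 \<le> \<alpha> n" "\<alpha> n \<le> 1" for n using alpha[of n] by auto
    show "0 < \<gamma> / 2" using gamma by simp
    show "x (2 * n + 2) = (1 - \<beta>' n) *\<^sub>R T (x (2 * n + 1)) + \<beta>' n *\<^sub>R x (2 * n + 1)" for n
    proof -
      have "(1 - \<beta>' n) * \<kappa> = 1 - \<beta> n" using \<kappa> by (simp add: \<beta>'_def)
      moreover have "(1 - \<beta>' n) * (1 - \<kappa>) + \<beta>' n = 1 - (1 - \<beta>' n) * \<kappa>" by (simp add: algebra_simps)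
      ultimately have coeff: "(1 - \<beta>' n) * \<kappa> = 1 - \<beta> n" "(1 - \<beta>' n) * (1 - \<kappa>) + \<beta>' n = \<beta> n" by auto
      have relaxed: "(1 - \<beta>' n) *\<^sub>R T y + \<beta>' n *\<^sub>R y = \<beta> n *\<^sub>R y + (1 - \<beta> n) *\<^sub>R F y" for y
      proof -
        have "(1 - \<beta>' n) *\<^sub>R T y + \<beta>' n *\<^sub>R y
            = ((1 - \<beta>' n) * (1 - \<kappa>) + \<beta>' n) *\<^sub>R y + ((1 - \<beta>' n) * \<kappa>) *\<^sub>R F y"
          by (simp only: T_def scaleR_add_right scaleR_add_left scaleR_scaleR) simp
        then show ?thesis by (simp only: coeff)
      qed
      show ?thesis unfolding relaxed x_even F_def by (rule add.commute)
    qed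
    show "(\<Sum>i = \<Gamma>4 \<epsilon> + 1..\<Gamma>4 \<epsilon> + n. \<bar>\<beta>' (i + 1) - \<beta>' i\<bar>) \<le> \<epsilon>" if "\<epsilon> > 0" for \<epsilon> n
      by (rule order_trans[OF sum_mono[OF \<beta>'_diff] Q4[OF that]])
    show "norm (x 0 - p) \<le> real N" using p(2) by (simp only: x_0)
  qed (fact \<beta>'_bounds x_odd N_pos p(3) mono_Gamma1 mono_Gamma2 mono_Gamma3 mono_Gamma4 Q1 Q2 Q3)+
  have "{y. T y = y} = zer (op_sum U1 (single_op U2))" using fixed_iff by blast
  then show ?thesis using convergence metastability by simp
qed

end
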